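(* Let $d\ge3$. There exists a positive (finite) value $u_c$ such that $$\theta(u)=\mathbb{P}\big(0\overset{\mathcal{V}^u}{\longleftrightarrow}\infty\big)=0\quad\text{for all }u>u_c .$$
   Context: $\mathsf{N}=\{0,1,2,\dots\}$; $|x|_1=\sum_i|x_i|$, $|x|_\infty=\max_i|x_i|$. Sites $x,y\in\mathsf{Z}^d$ are neighbors, $x\sim y$, if $|x-y|_1=1$. Let $J=\{(a,1):a\in\mathsf{Z}^{d-1},|a|_1=1\}\subset\mathsf{Z}^d$. Define $W=\{w:\mathsf{Z}\to\mathsf{Z}^d : w(n+1)-w(n)\in J\ \forall n\in\mathsf{Z}\}$ and $W_\pm=\{w:\mathsf{N}\to\mathsf{Z}^d: \pm(w(n+1)-w(n))\in J\ \forall n\in\mathsf{N}\}$, with the $\sigma$-algebras $\mathcal{W}$, $\mathcal{W}_\pm$ generated by the coordinate maps $X_n$. $P_x^+$ is the law on $W_+$ of the random walk started at $x$ with i.i.d. steps uniform on $J$; $P_x^-$ is the law on $W_-$ of the random walk started at $x$ with i.i.d. steps uniform on $-J$. On paths indexed by $\mathsf{N}$, $\widetilde H_K=\inf\{n\ge1:X_n\in K\}$. For $w\in W$, $H_K(w)=\inf\{n\in\mathsf{Z}:X_n(w)\in K\}$, $W_K^n=\{w\in W: H_K(w)=n\}$, $W_K=\bigcup_{n\in\mathsf{Z}}W_K^n$. $W^*$ is the quotient of $W$ by time shifts ($w\sim w'$ iff $w(\cdot)=w'(k+\cdot)$ for some $k\in\mathsf{Z}$), $\pi:W\to W^*$ is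 the projection, $\mathcal{W}^*=\{A\subset W^*:\pi^{-1}(A)\in\mathcal{W}\}$, $W_K^*=\pi(W_K)$. For finite $K\subset\mathsf{Z}^d$, $Q_K$ is the measure on $W$ supported on $W_K^0$ with $Q_K[(X_{-n})_{n\ge0}\in A,X_0=x,(X_n)_{n\ge0}\in B]=P_x^-(A\cap\{\widetilde H_K=\infty\})P_x^+(B)$ for $A\in\mathcal{W}_-$, $B\in\mathcal{W}_+$, $x\in K$. The measure $\nu$ is the unique measure on $(W^*,\mathcal{W}^* )$ such that $1_{W_K^*}\nu=Q_K\pi^{-1}$ for every finite $K\subset\mathsf{Z}^d$. Let $\Omega$ be the set of point measures $\omega=\sum_{n\ge0}\delta_{(w_n^*,u_n)}$ on $W^*\times\mathsf{R}_+$ with $\omega(W_K^*\times[0,u])<\infty$ for all finite $K\subset\mathsf{Z}^d$ and $u>0$, with the $\sigma$-algebra generated by the evaluation maps, and let $\mathbb{P}$ be the probability measure on $\Omega$ under which $\omega$ is a Poisson point process with intensity measure $\nu\otimes\lambda$ ($\lambda$ Lebesgue measure on $\mathsf{R}_+$). The (directed) random interlacement at level $u>0$ is $\mathcal{I}^u(\omega)=\bigcup_{n:\,u_n\le u}\mathrm{range}(w_n^* )$, where $\mathrm{range}(w^* )$ is the set of sites of $\mathsf{Z}^d$ visited by $w^*$. The vacant set is $\mathcal{V}^u=\mathsf{Z}^d\setminus\mathcal{I}^u$. The event $x\overset{\mathcal{V}^u}{\longleftrightarrow}y$ means that there are $x=x_0\sim x_1\sim\dots\sim x_n=y$ with all $x_i\in\mathcal{V}^u$,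 and $\{0\overset{\mathcal{V}^u}{\longleftrightarrow}\infty\}=\bigcap_{n\ge1}\{\exists x\in\mathsf{Z}^d:|x|_\infty\ge n,\ 0\overset{\mathcal{V}^u}{\longleftrightarrow}x\}$. *)

theory Defs
  imports "HOL-Probability.Probability"
begin

text \<open>
  \<open>\<int>\<^sup>d\<close> is \<^typ>\<open>int ^ 'd\<close> with \<open>d = CARD('d)\<close>. The linear order on \<^typ>\<open>'d\<close> serves only to
  single out the last coordinate \<open>Max UNIV\<close>, along which the walks are directed.
\<close>

type_synonym 'd site = "(int, 'd) vec"

definition norm_1 :: "'d::finite site \<Rightarrow> int" where
  "norm_1 x = (\<Sum>i\<in>UNIV. \<bar>x $ i\<bar>)"

definition norm_inf :: "'d::finite site \<Rightarrow> int" where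
  "norm_inf x = Max (range (\<lambda>i. \<bar>x $ i\<bar>))"

definition neighbors :: "'d::finite site \<Rightarrow> 'd site \<Rightarrow> bool" where
  "neighbors x y \<longleftrightarrow> norm_1 (x - y) = 1"

text \<open>The points \<open>(a, 1)\<close> with \<open>a \<in> \<int>\<^sup>d\<^sup>-\<^sup>1\<close> and \<open>\<bar>a\<bar>\<^sub>1 = 1\<close>.\<close>

definition J :: "'d::{finite,linorder} site set" where
  "J = {v. (\<Sum>i\<in>UNIV - {Max UNIV}. \<bar>v $ i\<bar>) = 1 \<and> v $ Max UNIV = 1}"


subsection \<open>Paths and random walks\<close>

definition W :: "(int \<Rightarrow> 'd::{finite,linorder} site) set" where
  "W = {w. \<forall>n. w (n + 1) - w n \<in> J}"

definition paths :: "'d::finite site set \<Rightarrow> (nat \<Rightarrow> 'd site) set" where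
  "paths S = {w. \<forall>n. w (n + 1) - w n \<in> S}"

abbreviation W_plus :: "(nat \<Rightarrow> 'd::{finite,linorder} site) set" where
  "W_plus \<equiv> paths J"

abbreviation W_minus :: "(nat \<Rightarrow> 'd::{finite,linorder} site) set" where
  "W_minus \<equiv> paths (uminus ` J)"

text \<open>
  The \<open>\<sigma>\<close>-algebra generated by the coordinate maps on a set \<open>A\<close> of paths, for one-sided and
  two-sided paths alike; the measure it carries is irrelevant.
\<close>

definition coord_algebra :: "('i \<Rightarrow> 'd::finite site) set \<Rightarrow> ('i \<Rightarrow> 'd site) measure" where
  "coord_algebra A = restrict_space (Pi\<^sub>M UNIV (\<lambda>_. count_space UNIV)) A"

text \<open>
  The law of the walk from \<open>x\<close> with i.i.d. steps uniform on the finite set \<open>S\<close>. The step sequences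
  range over \<open>S\<close> everywhere and not just almost surely, so that the image lies in \<open>paths S\<close>.
\<close>

definition walk_law :: "'d::finite site set \<Rightarrow> 'd site \<Rightarrow> (nat \<Rightarrow> 'd site) measure" where
  "walk_law S x =
     distr (Pi\<^sub>M UNIV (\<lambda>_::nat. uniform_count_measure S)) (coord_algebra (paths S))
       (\<lambda>\<xi> n. x + (\<Sum>i<n. \<xi> i))"

abbreviation P_plus :: "'d site \<Rightarrow> (nat \<Rightarrow> 'd::{finite,linorder} site) measure" where
  "P_plus \<equiv> walk_law J"

abbreviation P_minus :: "'d site \<Rightarrow> (nat \<Rightarrow> 'd::{finite,linorder} site) measure" where
  "P_minus \<equiv> walk_law (uminus ` J)"

definition hitting_time_tilde :: "'d::finite site set \<Rightarrow> (nat \<Rightarrow> 'd site) \<Rightarrow> enat" where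
  "hitting_time_tilde K w = Inf {enat n | n. 1 \<le> n \<and> w n \<in> K}"

definition hitting_time :: "'d::finite site set \<Rightarrow> (int \<Rightarrow> 'd site) \<Rightarrow> ereal" where
  "hitting_time K w = Inf {ereal (real_of_int n) | n. w n \<in> K}"

definition W_at :: "'d::{finite,linorder} site set \<Rightarrow> int \<Rightarrow> (int \<Rightarrow> 'd site) set" where
  "W_at K n = {w \<in> W. hitting_time K w = ereal (real_of_int n)}"

definition W_hit :: "'d::{finite,linorder} site set \<Rightarrow> (int \<Rightarrow> 'd site) set" where
  "W_hit K = (\<Union>n. W_at K n)"


subsection \<open>Paths modulo time shift and the intensity measure\<close>

definition shift_rel :: "((int \<Rightarrow> 'd site) \<times> (int \<Rightarrow> 'd::{finite,linorder} site)) set" where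
  "shift_rel = {(w, w'). w \<in> W \<and> w' \<in> W \<and> (\<exists>k. \<forall>n. w n = w' (k + n))}"

type_synonym 'd traj = "(int \<Rightarrow> 'd site) set"

definition W_star :: "'d::{finite,linorder} traj set" where
  "W_star = W // shift_rel"

definition proj :: "(int \<Rightarrow> 'd::{finite,linorder} site) \<Rightarrow> 'd traj" where
  "proj w = shift_rel `` {w}"

definition W_star_algebra :: "'d::{finite,linorder} traj measure" where
  "W_star_algebra =
     sigma W_star {A. A \<subseteq> W_star \<and> proj -` A \<inter> W \<in> sets (coord_algebra W)}"

definition W_star_hit :: "'d::{finite,linorder} site set \<Rightarrow> 'd traj set" where
  "W_star_hit K = proj ` W_hit K"

definition traj_range :: "'d::finite traj \<Rightarrow> 'd site set" where
  "traj_range w' = (\<Union>w\<in>w'. range w)"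

text \<open>
  \<open>is_Q K Q\<close> says that \<open>Q\<close> is the measure \<open>Q\<^sub>K\<close>; the stated properties determine it.
\<close>

definition is_Q ::
    "'d::{finite,linorder} site set \<Rightarrow> (int \<Rightarrow> 'd site) measure \<Rightarrow> bool" where
  "is_Q K Q \<longleftrightarrow>
     sets Q = sets (coord_algebra W) \<and>
     (AE w in Q. w \<in> W_at K 0) \<and>
     (\<forall>A \<in> sets (coord_algebra W_minus). \<forall>B \<in> sets (coord_algebra W_plus). \<forall>x\<in>K.
        emeasure Q {w \<in> W. (\<lambda>n::nat. w (- int n)) \<in> A \<and> w 0 = x \<and> (\<lambda>n::nat. w (int n)) \<in> B} =
        emeasure (P_minus x) (A \<inter> {w. hitting_time_tilde K w = \<infinity>}) * emeasure (P_plus x) B)"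

text \<open>
  \<open>is_nu \<nu>\<close> says that \<open>\<nu>\<close> is the intensity measure on trajectories modulo time shift. It is
  determined by its restrictions to the sets \<open>W_star_hit K\<close>, since countably many of them cover
  \<open>W_star\<close>.
\<close>

definition is_nu :: "'d::{finite,linorder} traj measure \<Rightarrow> bool" where
  "is_nu \<nu> \<longleftrightarrow>
     sets \<nu> = sets W_star_algebra \<and>
     (\<forall>K. finite K \<longrightarrow>
        (\<exists>Q. is_Q K Q \<and>
           density \<nu> (indicator (W_star_hit K)) = distr Q W_star_algebra proj))"


subsection \<open>The Poisson point process\<close>

definition half_line :: "real measure" where
  "half_line = restrict_space lborel {0..}"

definition mark_space :: "('d::{finite,linorder} traj \<times> real) measure" where
  "mark_space = W_star_algebra \<Otimes>\<^sub>M half_line"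

text \<open>
  The image of the counting measure on the natural numbers under \<open>p\<close>, which is
  \<open>\<Sum>n. \<delta>\<^bsub>p n\<^esub>\<close>.
\<close>

definition dirac_sum ::
    "(nat \<Rightarrow> 'd::{finite,linorder} traj \<times> real) \<Rightarrow> ('d traj \<times> real) measure" where
  "dirac_sum p = distr (count_space UNIV) mark_space p"

definition Omega :: "('d::{finite,linorder} traj \<times> real) measure set" where
  "Omega = {dirac_sum p | p. range p \<subseteq> space mark_space \<and>
     (\<forall>K u. finite K \<and> 0 < u \<longrightarrow> emeasure (dirac_sum p) (W_star_hit K \<times> {0..u}) < \<infinity>)}"

definition Omega_algebra :: "('d::{finite,linorder} traj \<times> real) measure measure" where
  "Omega_algebra =
     sigma Omega {(\<lambda>\<omega>. emeasure \<omega> D) -` B \<inter> Omega | D B. D \<in> sets mark_space \<and> B \<in> sets borel}"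

definition is_poisson_process :: "'a measure \<Rightarrow> 'a measure measure \<Rightarrow> bool" where
  "is_poisson_process \<mu> P \<longleftrightarrow>
     (\<forall>D \<in> sets \<mu>. emeasure \<mu> D < \<infinity> \<longrightarrow>
        (\<forall>k::nat. measure P {\<omega> \<in> space P. emeasure \<omega> D = of_nat k} =
           exp (- measure \<mu> D) * measure \<mu> D ^ k / fact k)) \<and>
     (\<forall>D \<in> sets \<mu>. emeasure \<mu> D = \<infinity> \<longrightarrow> (AE \<omega> in P. emeasure \<omega> D = \<infinity>)) \<and>
     (\<forall>(n::nat) D. (\<forall>i<n. D i \<in> sets \<mu>) \<and> disjoint_family_on D {..<n} \<longrightarrow>
        prob_space.indep_vars P (\<lambda>_. borel) (\<lambda>i \<omega>. emeasure \<omega> (D i)) {..<n})"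

definition is_interlacement_law ::
    "'d::{finite,linorder} traj measure \<Rightarrow> ('d traj \<times> real) measure measure \<Rightarrow> bool" where
  "is_interlacement_law \<nu> P \<longleftrightarrow>
     prob_space P \<and> sets P = sets Omega_algebra \<and>
     is_poisson_process (\<nu> \<Otimes>\<^sub>M half_line) P"


subsection \<open>Interlacement, vacant set and percolation\<close>

text \<open>The set does not depend on the representation \<open>p\<close> of \<open>\<omega>\<close>; see \<open>interlacement_iff\<close> below.\<close>

definition interlacement ::
    "real \<Rightarrow> ('d::{finite,linorder} traj \<times> real) measure \<Rightarrow> 'd site set" where
  "interlacement u \<omega> =
     \<Union> {traj_range (fst (p n)) | p n. range p \<subseteq> space mark_space \<and> \<omega> = dirac_sum p \<and>
         snd (p n) \<le> u}"

definition vacant_set ::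
    "real \<Rightarrow> ('d::{finite,linorder} traj \<times> real) measure \<Rightarrow> 'd site set" where
  "vacant_set u \<omega> = UNIV - interlacement u \<omega>"

definition connected_in :: "'d::finite site set \<Rightarrow> 'd site \<Rightarrow> 'd site \<Rightarrow> bool" where
  "connected_in V x y \<longleftrightarrow>
     (\<exists>(n::nat) z. z 0 = x \<and> z n = y \<and> (\<forall>i<n. neighbors (z i) (z (i + 1))) \<and> (\<forall>i\<le>n. z i \<in> V))"

definition connected_to_infinity :: "'d::finite site set \<Rightarrow> bool" where
  "connected_to_infinity V \<longleftrightarrow>
     (\<forall>n::nat. 1 \<le> n \<longrightarrow> (\<exists>x. int n \<le> norm_inf x \<and> connected_in V 0 x))"

definition theta :: "('d::{finite,linorder} traj \<times> real) measure measure \<Rightarrow> real \<Rightarrow> real" where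
  "theta P u = measure P {\<omega> \<in> space P. connected_to_infinity (vacant_set u \<omega>)}"


subsection \<open>Well-definedness\<close>

lemma finite_J: "finite (J :: 'd::{finite,linorder} site set)"
proof (rule finite_subset)
  let ?F = "vec_lambda ` (Pi\<^sub>E UNIV (\<lambda>_::'d. {-1..1::int}))"
  show "finite ?F" by (intro finite_imageI finite_PiE) auto
  show "J \<subseteq> ?F"
  proof
    fix v :: "'d site" assume v: "v \<in> J"
    have "\<bar>v $ i\<bar> \<le> 1" for i
    proof (cases "i = Max UNIV")
      case False
      then have "\<bar>v $ i\<bar> \<le> (\<Sum>i\<in>UNIV - {Max UNIV}. \<bar>v $ i\<bar>)" by (intro member_le_sum) auto
      then show ?thesis using v by (simp add: J_def)
    qed (use v in \<open>simp add: J_def\<close>)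
    then have "vec_nth v \<in> Pi\<^sub>E UNIV (\<lambda>_. {-1..1})" by (auto simp: abs_le_iff minus_le_iff)
    then show "v \<in> ?F" by (intro image_eqI[of _ _ "vec_nth v"]) simp_all
  qed
qed

lemma J_nonempty:
  assumes "2 \<le> CARD('d)"
  shows "(J :: 'd::{finite,linorder} site set) \<noteq> {}"
proof -
  have "UNIV \<noteq> {Max (UNIV :: 'd set)}" 
  proof
    assume "UNIV = {Max (UNIV :: 'd set)}"
    then have "CARD('d) = card {Max (UNIV :: 'd set)}" by (rule arg_cong)
    then show False using assms by simp
  qed
  then obtain j :: 'd where j: "j \<noteq> Max UNIV" by blast
  have "(\<chi> i. if i = j \<or> i = Max UNIV then 1 else 0) \<in> (J :: 'd site set)"
  proof -
    have "(\<Sum>i\<in>UNIV - {Max UNIV}. \<bar>if i = j \<or> i = Max UNIV then 1 else 0 :: int\<bar>) =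
      (\<Sum>i\<in>UNIV - {Max UNIV}. if i = j then 1 else 0)" by (rule sum.cong) auto
    also have "\<dots> = 1" using j by (simp add: sum.delta)
    finally show ?thesis by (simp add: J_def)
  qed
  then show ?thesis by blast
qed
lemma prob_space_walk_law:
  assumes "finite S" "S \<noteq> {}"
  shows "prob_space (walk_law S x)"
proof -
  interpret product_prob_space "\<lambda>_::nat. uniform_count_measure S" UNIV
    by (intro product_prob_spaceI prob_space_uniform_count_measure assms)
  let ?M = "Pi\<^sub>M UNIV (\<lambda>_::nat. uniform_count_measure S)"
  have e: "(\<lambda>y. y) \<in> measurable (uniform_count_measure S) (count_space UNIV)"
    by (simp add: measurable_def space_uniform_count_measure sets_uniform_count_measure)
  have c: "(\<lambda>\<xi>. \<xi> i) \<in> measurable ?M (count_space UNIV)" for i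
  proof -
    have "(\<lambda>\<xi>. \<xi> i) \<in> measurable ?M (uniform_count_measure S)"
      by (rule measurable_component_singleton) simp
    from measurable_compose[OF this e] show ?thesis by simp
  qed
  have sm: "(\<lambda>\<xi>. x + (\<Sum>i<n. \<xi> i)) \<in> measurable ?M (count_space UNIV)" for n :: nat
  proof (induction n)
    case (Suc n)
    have "(\<lambda>\<xi>. (\<lambda>a b. a + b) (x + (\<Sum>i<n. \<xi> i)) (\<xi> n)) \<in> measurable ?M (count_space UNIV)"
      by (rule measurable_compose_countable[OF _ Suc], rule measurable_compose[OF c]) simp
    then show ?case by (simp add: add.assoc)
  qed simp
  have "(\<lambda>\<xi> n. x + (\<Sum>i<n. \<xi> i)) \<in> measurable ?M (coord_algebra (paths S))"
    unfolding coord_algebra_def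
  proof (rule measurable_restrict_space2)
    show "(\<lambda>\<xi> n. x + (\<Sum>i<n. \<xi> i)) \<in> space ?M \<rightarrow> paths S"
      by (auto simp: paths_def space_PiM space_uniform_count_measure PiE_iff algebra_simps)
    show "(\<lambda>\<xi> n. x + (\<Sum>i<n. \<xi> i)) \<in> measurable ?M (Pi\<^sub>M UNIV (\<lambda>_. count_space UNIV))"
      by (rule measurable_PiM_single') (auto simp: sm)
  qed
  then show ?thesis unfolding walk_law_def by (rule prob_space_distr)
qed

lemma last_coordinate:
  assumes "w \<in> W"
  shows "w (m + int k) $ Max UNIV = w m $ Max UNIV + int k"
proof (induction k)
  case (Suc k)
  have "w (m + int k + 1) - w (m + int k) \<in> J" using assms by (simp add: W_def)
  then have "w (m + int k + 1) $ Max UNIV - w (m + int k) $ Max UNIV = 1" by (simp add: J_def)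
  then show ?case using Suc by (simp add: ac_simps)
qed simp

lemma W_hit_iff:
  assumes "finite K"
  shows "w \<in> W_hit K \<longleftrightarrow> w \<in> W \<and> (\<exists>n. w n \<in> K)"
proof
  assume w: "w \<in> W_hit K"
  then obtain n where n: "w \<in> W" "hitting_time K w = ereal (real_of_int n)"
    by (auto simp: W_hit_def W_at_def)
  have "{ereal (real_of_int n) | n. w n \<in> K} \<noteq> {}"
  proof
    assume "{ereal (real_of_int n) | n. w n \<in> K} = {}"
    then have "hitting_time K w = \<infinity>" unfolding hitting_time_def by (simp add: top_ereal_def del: Collect_empty_eq)
    then show False using n by simp
  qed
  then show "w \<in> W \<and> (\<exists>n. w n \<in> K)" using n by auto
next
  assume a: "w \<in> W \<and> (\<exists>n. w n \<in> K)"
  let ?N = "{n. w n \<in> K}"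
  have "inj w"
  proof (rule linorder_injI)
    fix m n :: int assume "m < n"
    then show "w m \<noteq> w n"
      using last_coordinate[of w m "nat (n - m)"] a by auto
  qed
  then have fin: "finite ?N" using finite_vimageI[OF assms] by (simp add: vimage_def)
  have m: "Min ?N \<in> ?N" using Min_in[OF fin] a by auto
  have "hitting_time K w = ereal (real_of_int (Min ?N))"
    unfolding hitting_time_def
  proof (rule cInf_eq_minimum)
    show "ereal (real_of_int (Min ?N)) \<in> {ereal (real_of_int n) |n. w n \<in> K}" using m by auto
    fix x assume "x \<in> {ereal (real_of_int n) |n. w n \<in> K}"
    then show "ereal (real_of_int (Min ?N)) \<le> x" using Min_le[OF fin] by auto
  qed
  then show "w \<in> W_hit K" using a by (auto simp: W_hit_def W_at_def)
qed

lemma equiv_shift_rel: "equiv (W :: (int \<Rightarrow> 'd::{finite,linorder} site) set) shift_rel"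
proof (rule equivI)
  show "refl_on (W :: (int \<Rightarrow> 'd site) set) shift_rel"
    by (auto simp: refl_on_def shift_rel_def intro: exI[of _ 0])
  show "sym (shift_rel :: ((int \<Rightarrow> 'd site) \<times> _) set)"
  proof (rule symI)
    fix w w' :: "int \<Rightarrow> 'd site" assume "(w, w') \<in> shift_rel"
    then obtain k where k: "w \<in> W" "w' \<in> W" "\<And>n. w n = w' (k + n)" by (auto simp: shift_rel_def)
    then have "\<forall>n. w' n = w (- k + n)" by simp
    then show "(w', w) \<in> shift_rel" unfolding shift_rel_def using k(1,2) by blast
  qed
  show "trans (shift_rel :: ((int \<Rightarrow> 'd site) \<times> _) set)"
  proof (rule transI)
    fix w w' w'' :: "int \<Rightarrow> 'd site"
    assume "(w, w') \<in> shift_rel" "(w', w'') \<in> shift_rel"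
    then obtain k l where k: "w \<in> W" "w'' \<in> W" "\<And>n. w n = w' (k + n)" "\<And>n. w' n = w'' (l + n)"
      by (auto simp: shift_rel_def)
    then have "\<forall>n. w n = w'' (l + k + n)" by (simp add: add.assoc)
    then show "(w, w'') \<in> shift_rel" unfolding shift_rel_def using k(1,2) by blast
  qed
qed (auto simp: shift_rel_def)

lemma traj_range_proj:
  assumes "w \<in> W"
  shows "traj_range (proj w) = range w"
proof -
  have "w \<in> proj w"
    unfolding proj_def by (rule equiv_class_self[OF equiv_shift_rel assms])
  moreover have "range w' = range w" if "w' \<in> proj w" for w'
  proof -
    have "(w, w') \<in> shift_rel" using that by (simp add: proj_def)
    then obtain k where "\<forall>n. w n = w' (k + n)" by (force simp: shift_rel_def)
    then have "w = (\<lambda>n. w' (k + n))" by (intro ext) (rule spec)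
    moreover have "range (\<lambda>n. w' (k + n)) = range w'"
    proof
      show "range w' \<subseteq> range (\<lambda>n. w' (k + n))"
      proof
        fix x assume "x \<in> range w'"
        then obtain n where "x = w' (k + (n - k))" by auto
        then show "x \<in> range (\<lambda>n. w' (k + n))" by (rule range_eqI)
      qed
    qed auto
    ultimately show ?thesis by (simp only:)
  qed
  ultimately show ?thesis unfolding traj_range_def by fast
qed

lemma W_star_eq: "W_star = proj ` W"
  by (auto simp: W_star_def quotient_def proj_def)

lemma W_star_hit_iff:
  assumes "finite K"
  shows "w' \<in> W_star_hit K \<longleftrightarrow> w' \<in> W_star \<and> traj_range w' \<inter> K \<noteq> {}"
proof -
  have "proj w \<in> W_star_hit K \<longleftrightarrow> range w \<inter> K \<noteq> {}" if "w \<in> W" for w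
  proof
    assume "proj w \<in> W_star_hit K"
    then obtain v where v: "proj w = proj v" "v \<in> W" "range v \<inter> K \<noteq> {}"
      by (fastforce simp: W_star_hit_def W_hit_iff[OF assms])
    have "range w = range v"
      unfolding traj_range_proj[OF that, symmetric] traj_range_proj[OF v(2), symmetric] v(1) ..
    then show "range w \<inter> K \<noteq> {}" using v(3) by (simp only:) simp
  next
    assume "range w \<inter> K \<noteq> {}"
    then have "w \<in> W_hit K" using that W_hit_iff[OF assms] by blast
    then show "proj w \<in> W_star_hit K" by (simp add: W_star_hit_def)
  qed
  moreover have "W_star_hit K \<subseteq> W_star" by (auto simp: W_star_hit_def W_star_eq W_hit_iff[OF assms])
  moreover have "w' \<in> W_star \<longleftrightarrow> (\<exists>w\<in>W. w' = proj w)" by (auto simp: W_star_eq)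
  ultimately show ?thesis by (metis (no_types, lifting) traj_range_proj subsetD)
qed

lemma sets_W_star_hit:
  assumes "finite K"
  shows "W_star_hit K \<in> sets W_star_algebra"
proof -
  have 1: "proj -` W_star_hit K \<inter> W = (\<Union>n. {w. w n \<in> K} \<inter> W)"
    using W_star_hit_iff[OF assms] by (force simp: W_star_eq traj_range_proj)
  have "{w. w n \<in> K} \<in> sets (Pi\<^sub>M UNIV (\<lambda>_. count_space UNIV))" for n :: int
  proof -
    have "(\<lambda>w. w n) -` K \<inter> space (Pi\<^sub>M UNIV (\<lambda>_. count_space UNIV))
        \<in> sets (Pi\<^sub>M UNIV (\<lambda>_. count_space UNIV))"
      by (rule measurable_sets[OF measurable_component_singleton]) auto
    then show ?thesis by (simp add: space_PiM vimage_def)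
  qed
  then have "(\<Union>n. {w. w n \<in> K} \<inter> W) \<in> sets (coord_algebra W)"
    unfolding coord_algebra_def
    by (intro sets.countable_UN) (auto simp: sets_restrict_space Int_commute)
  moreover have "W_star_hit K \<subseteq> W_star" using W_star_hit_iff[OF assms] by auto
  ultimately show ?thesis unfolding W_star_algebra_def using 1 by (intro in_measure_of) auto
qed

lemma space_mark_space: "space mark_space = W_star \<times> {0..}"
  by (simp add: mark_space_def space_pair_measure W_star_algebra_def half_line_def
      space_restrict_space space_measure_of_conv)

lemma sets_hit_box:
  assumes "finite K"
  shows "W_star_hit K \<times> {0..u} \<in> sets mark_space"
  unfolding mark_space_def half_line_def
  by (intro pair_measureI sets_W_star_hit assms) (auto simp: sets_restrict_space_iff)

lemma emeasure_dirac_sum: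
  assumes "range p \<subseteq> space mark_space" "D \<in> sets mark_space"
  shows "emeasure (dirac_sum p) D = emeasure (count_space UNIV) (p -` D)"
  unfolding dirac_sum_def using assms by (subst emeasure_distr) (auto simp: measurable_def)

lemma interlacement_iff:
  assumes "\<omega> \<in> Omega"
  shows "x \<in> interlacement u \<omega> \<longleftrightarrow> emeasure \<omega> (W_star_hit {x} \<times> {0..u}) \<noteq> 0"
proof -
  have *: "emeasure \<omega> (W_star_hit {x} \<times> {0..u}) \<noteq> 0 \<longleftrightarrow>
      (\<exists>n. x \<in> traj_range (fst (p n)) \<and> snd (p n) \<le> u)"
    if p: "range p \<subseteq> space mark_space" "\<omega> = dirac_sum p" for p
  proof -
    have "p n \<in> W_star \<times> {0..}" for n using p(1) by (auto simp: space_mark_space)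
    then have "p n \<in> W_star_hit {x} \<times> {0..u} \<longleftrightarrow> x \<in> traj_range (fst (p n)) \<and> snd (p n) \<le> u" for n
      by (simp add: mem_Times_iff W_star_hit_iff)
    moreover have "emeasure \<omega> (W_star_hit {x} \<times> {0..u}) \<noteq> 0 \<longleftrightarrow>
        p -` (W_star_hit {x} \<times> {0..u}) \<noteq> {}"
      unfolding p(2) by (subst emeasure_dirac_sum[OF p(1)])
        (auto simp: sets_hit_box emeasure_count_space_eq_0)
    ultimately show ?thesis by (simp add: vimage_def del: mem_Times_iff)
  qed
  obtain p where "range p \<subseteq> space mark_space" "\<omega> = dirac_sum p"
    using assms by (auto simp: Omega_def)
  moreover have "x \<in> interlacement u \<omega> \<longleftrightarrow> (\<exists>p. range p \<subseteq> space mark_space \<and> \<omega> = dirac_sum p \<and>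
      (\<exists>n. x \<in> traj_range (fst (p n)) \<and> snd (p n) \<le> u))"
    unfolding interlacement_def by blast
  ultimately show ?thesis using * by blast
qed

lemma connected_in_iff_list:
  "connected_in V x y \<longleftrightarrow> (\<exists>zs. zs \<noteq> [] \<and> zs ! 0 = x \<and> zs ! (length zs - 1) = y \<and>
     (\<forall>i<length zs - 1. neighbors (zs ! i) (zs ! (i + 1))) \<and> set zs \<subseteq> V)"
proof
  assume "connected_in V x y"
  then obtain n :: nat and z where z: "z 0 = x" "z n = y" "\<forall>i<n. neighbors (z i) (z (i + 1))" "\<forall>i\<le>n. z i \<in> V"
    unfolding connected_in_def by blast
  show "\<exists>zs. zs \<noteq> [] \<and> zs ! 0 = x \<and> zs ! (length zs - 1) = y \<and>
     (\<forall>i<length zs - 1. neighbors (zs ! i) (zs ! (i + 1))) \<and> set zs \<subseteq> V"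
  proof (rule exI[of _ "map z [0..<Suc n]"], intro conjI)
    show "map z [0..<Suc n] ! 0 = x" "map z [0..<Suc n] ! (length (map z [0..<Suc n]) - 1) = y"
      using z(1,2) by (simp_all del: upt_Suc)
    show "\<forall>i<length (map z [0..<Suc n]) - 1.
        neighbors (map z [0..<Suc n] ! i) (map z [0..<Suc n] ! (i + 1))"
      using z(3) by (simp del: upt_Suc)
    show "set (map z [0..<Suc n]) \<subseteq> V" using z(4) by (auto simp del: upt_Suc)
  qed simp
next
  assume "\<exists>zs. zs \<noteq> [] \<and> zs ! 0 = x \<and> zs ! (length zs - 1) = y \<and>
     (\<forall>i<length zs - 1. neighbors (zs ! i) (zs ! (i + 1))) \<and> set zs \<subseteq> V"
  then obtain zs where zs: "zs \<noteq> []" "zs ! 0 = x" "zs ! (length zs - 1) = y"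
     "\<forall>i<length zs - 1. neighbors (zs ! i) (zs ! (i + 1))" "set zs \<subseteq> V" by blast
  have "zs ! i \<in> V" if "i \<le> length zs - 1" for i
  proof -
    have "i < length zs" using zs(1) that by (cases zs) auto
    then show ?thesis using zs(5) nth_mem by blast
  qed
  then show "connected_in V x y" unfolding connected_in_def
    using zs(2-4) by (intro exI[of _ "length zs - 1"] exI[of _ "\<lambda>i. zs ! i"]) blast
qed

lemma space_Omega_algebra: "space Omega_algebra = Omega"
  unfolding Omega_algebra_def by (rule space_measure_of) auto

text \<open>Hence \<open>theta\<close> does not pick up the default value \<open>0\<close> of a non-measurable set.\<close>

lemma measurable_percolation_event:
  "{\<omega> \<in> space Omega_algebra. connected_to_infinity (vacant_set u \<omega>)} \<in> sets Omega_algebra"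
proof -
  have "{\<omega> \<in> Omega. x \<in> vacant_set u \<omega>} \<in> sets Omega_algebra" for x
  proof -
    have "{\<omega> \<in> Omega. x \<in> vacant_set u \<omega>} =
        (\<lambda>\<omega>. emeasure \<omega> (W_star_hit {x} \<times> {0..u})) -` {0} \<inter> Omega"
      by (auto simp: vacant_set_def interlacement_iff)
    moreover have "\<dots> \<in> sets Omega_algebra"
      unfolding Omega_algebra_def by (rule in_measure_of) (auto simp: sets_hit_box intro!: exI[of _ "_ \<times> _"] exI[of _ "{0}"])
    ultimately show ?thesis by simp
  qed
  then have [measurable]: "Measurable.pred Omega_algebra (\<lambda>\<omega>. x \<in> vacant_set u \<omega>)" for x
    by (simp add: pred_def space_Omega_algebra)
  show ?thesis
    unfolding connected_to_infinity_def connected_in_iff_list subset_iff Ball_def[symmetric]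
    by measurable
qed

end

theory Submission
  imports Defs
begin

text \<open>
  A vacant path from the origin to distance \<open>2 L\<^sup>k\<close> contains one of at most \<open>N ^ 2 ^ k\<close> sets of
  \<open>2 ^ k\<close> sites that are spread out like the leaves of a binary tree: two leaves whose branches join at level
  \<open>i + 1\<close> are at distance of order \<open>L\<^sup>i\<^sup>+\<^sup>1\<close> (a renormalization due to Rath and Sznitman). The directed walk
  passes a given site at distance \<open>r\<close> at time \<open>r\<close> or never, so it does so with probability
  \<open>O(r\<^sup>-\<^sup>1\<^sup>/\<^sup>2)\<close>. For large \<open>L\<close> the walk started backwards from a site of the set therefore avoids the set
  with probability at least \<open>1/2\<close>, so the trajectories hitting the set have \<open>\<nu>\<close>-mass at least
  \<open>2 ^ k / 2\<close>, and the set is vacant with probability at most \<open>exp (- u 2 ^ k / 2)\<close>. A union bound gives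
  \<open>(N exp (- u / 2)) ^ 2 ^ k\<close>, which tends to \<open>0\<close> as soon as \<open>u > 2 ln N\<close>.
\<close>

subsection \<open>Geometry of the lattice\<close>

lemma abs_component_le_norm_inf: "\<bar>x $ i\<bar> \<le> norm_inf x"
  unfolding norm_inf_def by (intro Max_ge) auto

lemma norm_inf_le_iff: "norm_inf x \<le> c \<longleftrightarrow> (\<forall>i. \<bar>x $ i\<bar> \<le> c)"
  unfolding norm_inf_def by (subst Max_le_iff) auto

lemma norm_inf_nonneg: "0 \<le> norm_inf x"
  using abs_component_le_norm_inf[of x undefined] by linarith

lemma norm_inf_eq_0: "norm_inf x = 0 \<longleftrightarrow> x = 0"
proof
  assume "norm_inf x = 0"
  then show "x = 0" using abs_component_le_norm_inf[of x] by (simp add: vec_eq_iff)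
next
  assume "x = 0"
  then show "norm_inf x = 0" using norm_inf_nonneg[of x] norm_inf_le_iff[of x 0] by simp
qed

lemma norm_inf_pos_iff: "0 < norm_inf x \<longleftrightarrow> x \<noteq> 0"
  using norm_inf_nonneg[of x] norm_inf_eq_0[of x] by linarith

lemma norm_inf_minus_commute: "norm_inf (x - y) = norm_inf (y - x)"
  unfolding norm_inf_def by (simp add: abs_minus_commute)

lemma norm_inf_triangle: "norm_inf (x - z) \<le> norm_inf (x - y) + norm_inf (y - z)"
  unfolding norm_inf_le_iff
proof
  fix i
  show "\<bar>(x - z) $ i\<bar> \<le> norm_inf (x - y) + norm_inf (y - z)"
    using abs_component_le_norm_inf[of "x - y" i] abs_component_le_norm_inf[of "y - z" i] by simp
qed

lemma neighbors_sym: "neighbors x y \<longleftrightarrow> neighbors y x"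
  by (simp add: neighbors_def norm_1_def abs_minus_commute)

lemma norm_inf_le_norm_1: "norm_inf x \<le> norm_1 x"
  unfolding norm_inf_le_iff norm_1_def by (auto intro: member_le_sum)

lemma connected_in_sym:
  assumes "connected_in V x y"
  shows "connected_in V y x"
proof -
  obtain n :: nat and z where z: "z 0 = x" "z n = y" "\<forall>i<n. neighbors (z i) (z (i + 1))" "\<forall>i\<le>n. z i \<in> V"
    using assms unfolding connected_in_def by blast
  have "neighbors (z (n - i)) (z (n - (i + 1)))" if "i < n" for i
    using z(3)[rule_format, of "n - (i + 1)"] that by (simp add: neighbors_sym Suc_diff_Suc)
  then show ?thesis unfolding connected_in_def
    using z by (intro exI[of _ n] exI[of _ "\<lambda>i. z (n - i)"]) auto
qed

lemma connected_in_start: "connected_in V x y \<Longrightarrow> x \<in> V"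
  unfolding connected_in_def by blast

text \<open>A lattice step changes the sup-distance to \<open>c\<close> by at most 1, because the
  sup norm is bounded by the 1-norm. The discrete intermediate value theorem along the path
  therefore finds a site at distance exactly \<open>r\<close>.\<close>

lemma connected_in_sphere:
  assumes "connected_in V x y" "norm_inf (x - c) \<le> r" "r \<le> norm_inf (y - c)"
  obtains z where "connected_in V x z" "norm_inf (z - c) = r"
proof -
  obtain n :: nat and z where z: "z 0 = x" "z n = y" "\<forall>i<n. neighbors (z i) (z (i + 1))" "\<forall>i\<le>n. z i \<in> V"
    using assms unfolding connected_in_def by blast
  have "\<bar>norm_inf (z (i + 1) - c) - norm_inf (z i - c)\<bar> \<le> 1" if "i < n" for i
  proof -
    have "norm_inf (z i - z (i + 1)) \<le> 1"
      using z(3) that norm_inf_le_norm_1[of "z i - z (i + 1)"] by (simp add: neighbors_def)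
    then show ?thesis
      using norm_inf_triangle[of "z i" c "z (i + 1)"] norm_inf_triangle[of "z (i + 1)" c "z i"]
        norm_inf_minus_commute[of "z i" "z (i + 1)"] by linarith
  qed
  then obtain i where i: "i \<le> n" "norm_inf (z i - c) = r"
    using nat0_intermed_int_val[of n "\<lambda>i. norm_inf (z i - c)" r] assms(2,3) z(1,2) by auto
  have "connected_in V x (z i)"
    unfolding connected_in_def using z i by (intro exI[of _ i] exI[of _ z]) auto
  then show thesis using that i by blast
qed

subsection \<open>Sparse skeletons of crossings\<close>

text \<open>The mesh \<open>L ^ k\<close> grows with the scale while the range of multiples stays
  fixed, so the number of grid points is bounded independently of \<open>k\<close> and
  \<open>x\<close>.\<close>

definition grid :: "int \<Rightarrow> nat \<Rightarrow> 'd::finite site \<Rightarrow> 'd site set" where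
  "grid L k x = (\<lambda>m. x + L ^ k *s m) ` {m. norm_inf m \<le> 3 * L}"

text \<open>
  If a path in \<open>V\<close> crosses the annulus between radii \<open>L\<^sup>k\<^sup>+\<^sup>1\<close> and \<open>2 L\<^sup>k\<^sup>+\<^sup>1\<close> around \<open>x\<close>, it crosses the
  corresponding annuli at scale \<open>k\<close> around grid points \<open>y\<close> near its start and \<open>z\<close> near its end;
  a skeleton at scale \<open>k + 1\<close> joins skeletons of these two crossings.
\<close>

fun skeletons :: "int \<Rightarrow> nat \<Rightarrow> 'd::finite site \<Rightarrow> 'd site set set" where
  "skeletons L 0 x = {{x}}"
| "skeletons L (Suc k) x = {X \<union> Y | X Y y z.
     y \<in> grid L k x \<and> z \<in> grid L k x \<and> norm_inf (y - x) \<le> 2 * L * L ^ k + L ^ k \<and>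
     norm_inf (z - x) \<le> 2 * L * L ^ k + L ^ k \<and>
     (L - 2) * L ^ k \<le> norm_inf (y - z) \<and> X \<in> skeletons L k y \<and> Y \<in> skeletons L k z}"

section \<open>The number of skeletons\<close>

lemma finite_norm_inf_ball: "finite {m :: 'd::finite site. norm_inf m \<le> c}"
proof (rule finite_subset)
  show "finite (vec_lambda ` (Pi\<^sub>E UNIV (\<lambda>_::'d. {-c..c})))" by (intro finite_imageI finite_PiE) auto
  show "{m. norm_inf m \<le> c} \<subseteq> vec_lambda ` (Pi\<^sub>E UNIV (\<lambda>_::'d. {-c..c}))"
  proof
    fix v :: "'d site" assume "v \<in> {m. norm_inf m \<le> c}"
    then have "vec_nth v \<in> Pi\<^sub>E UNIV (\<lambda>_. {-c..c})" by (auto simp: norm_inf_le_iff abs_le_iff minus_le_iff)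
    then show "v \<in> vec_lambda ` (Pi\<^sub>E UNIV (\<lambda>_::'d. {-c..c}))"
      by (intro image_eqI[of _ _ "vec_nth v"]) simp_all
  qed
qed

lemma finite_grid: "finite (grid L k x)"
  unfolding grid_def by (intro finite_imageI finite_norm_inf_ball)

text \<open>Choosing two centres in the grid costs at most \<open>D\<^sup>2\<close>, so the count
  c(k) satisfies c(k+1) <= \<open>D\<^sup>2\<close> c(k)^2. The extra factor
  \<open>D\<^sup>2\<close> on the left turns this into plain squaring, and the induction
  closes.\<close>

lemma finite_card_skeletons:
  fixes x :: "'d::finite site" and L :: int
  defines "D \<equiv> card {m :: 'd site. norm_inf m \<le> 3 * L}"
  shows "finite (skeletons L k x) \<and> D\<^sup>2 * card (skeletons L k x) \<le> (D\<^sup>2) ^ 2 ^ k"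
proof (induction k arbitrary: x)
  case (Suc k)
  define U where "U = (\<lambda>(y :: 'd site, z :: 'd site). (\<lambda>(X, Y). X \<union> Y) ` (skeletons L k y \<times> skeletons L k z))"
  let ?G = "grid L k x \<times> grid L k x"
  have card_G: "card ?G \<le> D\<^sup>2"
    unfolding card_cartesian_product power2_eq_square grid_def D_def
    by (intro mult_le_mono card_image_le finite_norm_inf_ball)
  have sub: "skeletons L (Suc k) x \<subseteq> \<Union> (U ` ?G)" unfolding U_def by force
  have fin: "finite (\<Union> (U ` ?G))"
    unfolding U_def using Suc by (auto intro!: finite_imageI simp: finite_grid)
  have U: "D\<^sup>2 * D\<^sup>2 * card (U p) \<le> (D\<^sup>2) ^ 2 ^ Suc k" for p
  proof -
    obtain y z where p: "p = (y, z)" by fastforce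
    have "card (U p) \<le> card (skeletons L k y) * card (skeletons L k z)"
      unfolding U_def p prod.case card_cartesian_product[symmetric] using Suc
      by (intro card_image_le finite_cartesian_product) auto
    then have "D\<^sup>2 * D\<^sup>2 * card (U p) \<le>
        (D\<^sup>2 * card (skeletons L k y)) * (D\<^sup>2 * card (skeletons L k z))"
      by (simp add: mult_ac)
    also have "\<dots> \<le> (D\<^sup>2) ^ 2 ^ k * (D\<^sup>2) ^ 2 ^ k" using Suc by (intro mult_le_mono) auto
    finally show ?thesis by (simp add: power_add[symmetric] mult_2)
  qed
  have "D\<^sup>2 * card (skeletons L (Suc k) x) \<le> D\<^sup>2 * card (\<Union> (U ` ?G))"
    using card_mono[OF fin sub] by simp
  also have "\<dots> \<le> D\<^sup>2 * (\<Sum>p\<in>?G. card (U p))"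
    by (intro mult_le_mono card_UN_le) (auto simp: finite_grid)
  also have "\<dots> \<le> (D\<^sup>2) ^ 2 ^ Suc k"
  \<comment> \<open>The bound is first proved with one more factor \<open>D\<^sup>2\<close> on both
    sides, which can be cancelled only if \<open>D\<close> is nonzero.\<close>
  proof (cases "D = 0")
    case False
    have "D\<^sup>2 * (D\<^sup>2 * (\<Sum>p\<in>?G. card (U p))) = (\<Sum>p\<in>?G. D\<^sup>2 * D\<^sup>2 * card (U p))"
      by (simp only: sum_distrib_left mult.assoc)
    also have "\<dots> \<le> card ?G * (D\<^sup>2) ^ 2 ^ Suc k"
      using sum_bounded_above[of ?G, OF U] by simp
    also have "\<dots> \<le> D\<^sup>2 * (D\<^sup>2) ^ 2 ^ Suc k" using card_G by (intro mult_le_mono) auto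
    finally show ?thesis using False by (simp only: mult_le_cancel1) simp
  qed simp
  finally show ?case using finite_subset[OF sub fin] by blast
qed simp

text \<open>The radius reproduces itself: a centre offset of (2L + 1) L^k plus the radius 3 L^k of
  the half is (2L + 4) L^k, which is at most 3 L^(k+1) once L >= 4.\<close>

lemma skeleton_subset_ball:
  assumes "4 \<le> L" "X \<in> skeletons L k x" "y \<in> X"
  shows "norm_inf (y - x) \<le> 3 * L ^ k"
  using assms(2,3)
proof (induction k arbitrary: x X)
  case 0
  then show ?case using norm_inf_eq_0[of "y - x"] by simp
next
  case (Suc k)
  then obtain z X' where z: "norm_inf (z - x) \<le> 2 * L * L ^ k + L ^ k" "X' \<in> skeletons L k z" "y \<in> X'"
    by auto
  have "norm_inf (y - x) \<le> 3 * L ^ k + (2 * L * L ^ k + L ^ k)"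
    using norm_inf_triangle[of y x z] Suc.IH[OF z(2,3)] z(1) by linarith
  also have "\<dots> = 2 * L * L ^ k + 4 * L ^ k" by simp
  also have "\<dots> \<le> 3 * L ^ Suc k" using mult_right_mono[OF assms(1), of "L ^ k"] assms(1) by simp
  finally show ?case .
qed

text \<open>The two centres are (L - 2) L^k apart and each half stays within 3 L^k of its centre, so
  6 L^k of the separation is lost.\<close>

lemma skeleton_Suc_cases:
  assumes "16 \<le> L" "X \<in> skeletons L (Suc k) x"
  obtains Y Z y z where "X = Y \<union> Z" "Y \<in> skeletons L k y" "Z \<in> skeletons L k z"
    "\<And>a b. a \<in> Y \<Longrightarrow> b \<in> Z \<Longrightarrow> (L - 8) * L ^ k \<le> norm_inf (a - b)"
proof -
  obtain Y Z y z where X: "X = Y \<union> Z" "Y \<in> skeletons L k y" "Z \<in> skeletons L k z"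
    and yz: "(L - 2) * L ^ k \<le> norm_inf (y - z)" using assms(2) by auto
  have "(L - 8) * L ^ k \<le> norm_inf (a - b)" if "a \<in> Y" "b \<in> Z" for a b
  proof -
    have "norm_inf (a - y) \<le> 3 * L ^ k" "norm_inf (b - z) \<le> 3 * L ^ k"
      using skeleton_subset_ball[OF _ X(2) that(1)] skeleton_subset_ball[OF _ X(3) that(2)] assms(1)
      by auto
    then have "(L - 2) * L ^ k \<le> 3 * L ^ k + norm_inf (a - b) + 3 * L ^ k"
      using yz norm_inf_triangle[of y z a] norm_inf_triangle[of a z b] norm_inf_minus_commute[of y a]
      by linarith
    then show ?thesis by (simp add: algebra_simps)
  qed
  then show thesis using that X by blast
qed

text \<open>The separation of the two halves is positive, so they are disjoint and the cardinality
  doubles at each scale.\<close>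

lemma skeleton_card:
  assumes "16 \<le> L" "X \<in> skeletons L k x"
  shows "finite X \<and> card X = 2 ^ k"
  using assms(2)
proof (induction k arbitrary: x X)
  case (Suc k)
  from skeleton_Suc_cases[OF assms(1) Suc.prems] obtain Y Z y z where X: "X = Y \<union> Z"
    "Y \<in> skeletons L k y" "Z \<in> skeletons L k z"
    and sep: "\<And>a b. a \<in> Y \<Longrightarrow> b \<in> Z \<Longrightarrow> (L - 8) * L ^ k \<le> norm_inf (a - b)" by metis
  have "0 < (L - 8) * L ^ k" using assms(1) by simp
  then have "Y \<inter> Z = {}" using sep norm_inf_eq_0[of "0 :: 'a site"] by fastforce
  then show ?case using Suc.IH[OF X(2)] Suc.IH[OF X(3)] X(1) by (simp add: card_Un_disjoint)
qed auto

text \<open>The half \<open>Z\<close> not containing \<open>a\<close> has 2^k sites at distance at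
  least (L - 8) 16^k. The square root of 16^k is 4^k, which beats the number of sites, so
  \<open>Z\<close> adds at most 2^(-k) / sqrt (L - 8). The bound 2 - 2/2^k is the partial sum of
  this geometric series.\<close>

lemma skeleton_sum_aux:
  assumes L: "16 \<le> L" and Y: "finite Y" "card Y = 2 ^ k" and Z: "finite Z" "card Z = 2 ^ k"
    and sep: "\<And>a b. a \<in> Y \<Longrightarrow> b \<in> Z \<Longrightarrow> (L - 8) * L ^ k \<le> norm_inf (a - b)"
    and a: "a \<in> Y"
    and IH: "(\<Sum>y\<in>Y - {a}. 1 / sqrt (norm_inf (a - y))) \<le> (2 - 2 / 2 ^ k) / sqrt (L - 8)"
  shows "(\<Sum>y\<in>Y \<union> Z - {a}. 1 / sqrt (norm_inf (a - y))) \<le> (2 - 2 / 2 ^ Suc k) / sqrt (L - 8)"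
proof -
  have pos: "0 < (L - 8) * L ^ k" using L by simp
  have aZ: "a \<notin> Z" and disj: "Y \<inter> Z = {}" using sep a pos norm_inf_eq_0[of "0 :: 'a site"] by fastforce+
  have "1 / sqrt (norm_inf (a - b)) \<le> 1 / (4 ^ k * sqrt (L - 8))" if "b \<in> Z" for b
  proof -
    have "(16::real) ^ k \<le> real_of_int L ^ k" using L by (intro power_mono) auto
    then have "real_of_int (L - 8) * 16 ^ k \<le> real_of_int (L - 8) * real_of_int L ^ k"
      using L by (intro mult_left_mono) auto
    also have "\<dots> = real_of_int ((L - 8) * L ^ k)" by simp
    also have "\<dots> \<le> norm_inf (a - b)" using sep[OF a that] by (simp only: of_int_le_iff)
    finally have "real_of_int (L - 8) * 16 ^ k \<le> norm_inf (a - b)" .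
    then have "sqrt (real_of_int (L - 8) * 16 ^ k) \<le> sqrt (norm_inf (a - b))" by (rule real_sqrt_le_mono)
    moreover have "sqrt (16 ^ k) = 4 ^ k" by (simp add: real_sqrt_power)
    moreover have "0 < norm_inf (a - b)" using sep[OF a that] pos by linarith
    ultimately show ?thesis using L by (intro divide_left_mono) (auto simp: real_sqrt_mult mult.commute)
  qed
  then have "(\<Sum>y\<in>Z. 1 / sqrt (norm_inf (a - y))) \<le> 2 ^ k * (1 / (4 ^ k * sqrt (L - 8)))"
    using sum_bounded_above[of Z "\<lambda>y. 1 / sqrt (norm_inf (a - y))" "1 / (4 ^ k * sqrt (L - 8))"] Z
    by simp
  also have "(4::real) ^ k = 2 ^ k * 2 ^ k" by (simp add: power_mult_distrib[symmetric])
  also have "2 ^ k * (1 / (2 ^ k * 2 ^ k * sqrt (L - 8))) = (1 / 2 ^ k) / sqrt (L - 8)" by simp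
  finally have *: "(\<Sum>y\<in>Z. 1 / sqrt (norm_inf (a - y))) \<le> (1 / 2 ^ k) / sqrt (L - 8)" .
  have "Y \<union> Z - {a} = (Y - {a}) \<union> Z" using aZ by blast
  then have "(\<Sum>y\<in>Y \<union> Z - {a}. 1 / sqrt (norm_inf (a - y))) =
      (\<Sum>y\<in>Y - {a}. 1 / sqrt (norm_inf (a - y))) + (\<Sum>y\<in>Z. 1 / sqrt (norm_inf (a - y)))"
    using disj Y(1) Z(1) by (simp only:) (subst sum.union_disjoint, auto)
  also have "\<dots> \<le> (2 - 2 / 2 ^ k) / sqrt (L - 8) + (1 / 2 ^ k) / sqrt (L - 8)"
    using IH * by linarith
  also have "\<dots> = (2 - 2 / 2 ^ Suc k) / sqrt (L - 8)"
    by (simp add: diff_divide_distrib)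
  finally show ?thesis .
qed

text \<open>The summand is, up to a constant, the bound used below for the probability that the
  directed walk from \<open>a\<close> visits \<open>y\<close>. The total is bounded uniformly in
  \<open>k\<close> and becomes small for large \<open>L\<close>.\<close>

lemma skeleton_sum:
  assumes "16 \<le> L" "X \<in> skeletons L k x" "a \<in> X"
  shows "(\<Sum>y\<in>X - {a}. 1 / sqrt (norm_inf (a - y))) \<le> (2 - 2 / 2 ^ k) / sqrt (L - 8)"
  using assms(2,3)
proof (induction k arbitrary: x X)
  case (Suc k)
  from skeleton_Suc_cases[OF assms(1) Suc.prems(1)] obtain Y Z y z where X: "X = Y \<union> Z"
    "Y \<in> skeletons L k y" "Z \<in> skeletons L k z"
    and sep: "\<And>a b. a \<in> Y \<Longrightarrow> b \<in> Z \<Longrightarrow> (L - 8) * L ^ k \<le> norm_inf (a - b)" by metis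
  have sep': "\<And>a b. a \<in> Z \<Longrightarrow> b \<in> Y \<Longrightarrow> (L - 8) * L ^ k \<le> norm_inf (a - b)"
    using sep norm_inf_minus_commute by metis
  have cY: "finite Y" "card Y = 2 ^ k" and cZ: "finite Z" "card Z = 2 ^ k"
    using skeleton_card[OF assms(1)] X(2,3) by blast+
  show ?case
  proof (cases "a \<in> Y")
    case True
    then show ?thesis
      unfolding X(1) using skeleton_sum_aux[OF assms(1) cY cZ sep _ Suc.IH[OF X(2)]] by blast
  next
    case False
    then have "a \<in> Z" using Suc.prems X(1) by blast
    then show ?thesis
      unfolding X(1) Un_commute[of Y]
      using skeleton_sum_aux[OF assms(1) cZ cY sep' _ Suc.IH[OF X(3)]] by blast
  qed
qed simp

text \<open>Coordinatewise integer division by \<open>L ^ k\<close> gives the grid point, and the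
  remainders, which lie between 0 and \<open>L ^ k - 1\<close>, give the error.\<close>

lemma grid_approximation:
  assumes "1 \<le> L" "norm_inf (z - x) \<le> 2 * L * L ^ k"
  obtains y where "y \<in> grid L k x" "norm_inf (z - y) \<le> L ^ k - 1"
proof -
  define m :: "'a site" where "m = (\<chi> i. (z - x) $ i div L ^ k)"
  have pos: "0 < L ^ k" using assms(1) by simp
  have "norm_inf m \<le> 3 * L"
    unfolding norm_inf_le_iff
  proof
    fix i
    have a: "\<bar>(z - x) $ i\<bar> \<le> 2 * L * L ^ k" using assms(2) norm_inf_le_iff by blast
    have "(z - x) $ i div L ^ k \<le> (2 * L * L ^ k) div L ^ k"
      using a pos by (intro zdiv_mono1) auto
    moreover have "(- (2 * L) * L ^ k) div L ^ k \<le> (z - x) $ i div L ^ k"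
      using a pos by (intro zdiv_mono1) auto
    moreover have "(2 * L * L ^ k) div L ^ k = 2 * L" "(- (2 * L) * L ^ k) div L ^ k = - (2 * L)"
      using pos by (simp_all only: nonzero_mult_div_cancel_right)
    ultimately show "\<bar>m $ i\<bar> \<le> 3 * L" using assms(1) by (simp add: m_def abs_le_iff)
  qed
  moreover have "norm_inf (z - (x + L ^ k *s m)) \<le> L ^ k - 1"
    unfolding norm_inf_le_iff
  proof
    fix i
    have "(z - (x + L ^ k *s m)) $ i = (z - x) $ i mod L ^ k"
      by (simp add: m_def minus_mult_div_eq_mod[symmetric])
    then show "\<bar>(z - (x + L ^ k *s m)) $ i\<bar> \<le> L ^ k - 1"
      using pos pos_mod_sign[of "L ^ k" "(z - x) $ i"] pos_mod_bound[of "L ^ k" "(z - x) $ i"] by simp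
  qed
  ultimately show thesis using that unfolding grid_def by blast
qed

text \<open>The starting bound is \<open>L ^ k - 1\<close> because this is the error of rounding to
  the grid, so the hypothesis is inherited at the smaller scale. At scale 0 it forces
  \<open>z = x\<close>.\<close>

lemma crossing_contains_skeleton:
  assumes "4 \<le> L" "connected_in V z z'" "norm_inf (z - x) \<le> L ^ k - 1" "2 * L ^ k \<le> norm_inf (z' - x)"
  obtains X where "X \<in> skeletons L k x" "X \<subseteq> V"
proof -
  have "\<exists>X\<in>skeletons L k x. X \<subseteq> V"
    using assms(2-)
  proof (induction k arbitrary: x z z')
    case 0
    then have "z = x" using norm_inf_nonneg[of "z - x"] norm_inf_eq_0[of "z - x"] by simp
    then show ?case using connected_in_start[OF 0(1)] by simp
  next
    case (Suc k)
    have pos: "0 < L ^ k" using assms(1) by simp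
    have L4: "4 * L ^ k \<le> L * L ^ k" using assms(1) pos by simp
    have zx2: "norm_inf (z - x) \<le> 2 * L * L ^ k" and zx2': "2 * L * L ^ k \<le> norm_inf (z' - x)"
      using Suc.prems(2,3) L4 pos unfolding power_Suc by linarith+
    \<comment> \<open>The path is stopped on the outer sphere so that its end is still within reach
      of the grid.\<close>
    from connected_in_sphere[OF Suc.prems(1) zx2 zx2']
    obtain t where t: "connected_in V z t" "norm_inf (t - x) = 2 * L * L ^ k" .
    obtain y where y: "y \<in> grid L k x" "norm_inf (z - y) \<le> L ^ k - 1"
      using grid_approximation[OF _ zx2] assms(1) by auto
    obtain s where s: "s \<in> grid L k x" "norm_inf (t - s) \<le> L ^ k - 1"
      using grid_approximation[OF _ eq_refl[OF t(2)]] assms(1) by auto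
    have zx: "norm_inf (z - x) \<le> L * L ^ k - 1" using Suc.prems(2) by simp
    have tz: "L * L ^ k + 1 \<le> norm_inf (t - z)"
      using norm_inf_triangle[of t x z] t(2) zx by linarith
    have "2 * L ^ k \<le> norm_inf (t - y)"
      using norm_inf_triangle[of t z y] y(2) tz L4 pos norm_inf_minus_commute[of z y] by linarith
    from Suc.IH[OF t(1) y(2) this] obtain X where X: "X \<in> skeletons L k y" "X \<subseteq> V" by blast
    have "2 * L ^ k \<le> norm_inf (z - s)"
      using norm_inf_triangle[of z t s] s(2) tz L4 pos norm_inf_minus_commute[of z t]
        norm_inf_minus_commute[of s t] by linarith
    \<comment> \<open>The second crossing is the same path run backwards from \<open>t\<close>. It
      leaves the small annulus around \<open>s\<close> because \<open>z\<close> and \<open>t\<close>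
      are more than \<open>L * L ^ k\<close> apart.\<close>
    from Suc.IH[OF connected_in_sym[OF t(1)] s(2) this]
    obtain Y where Y: "Y \<in> skeletons L k s" "Y \<subseteq> V" by blast
    have "norm_inf (y - x) \<le> 2 * L * L ^ k + L ^ k"
      using norm_inf_triangle[of y x z] zx y(2) norm_inf_minus_commute[of z y] L4 pos by linarith
    moreover have "norm_inf (s - x) \<le> 2 * L * L ^ k + L ^ k"
      using norm_inf_triangle[of s x t] t(2) s(2) norm_inf_minus_commute[of s t] by linarith
    moreover have "(L - 2) * L ^ k \<le> norm_inf (y - s)"
    proof -
      have "norm_inf (t - z) \<le> norm_inf (t - s) + norm_inf (s - y) + norm_inf (y - z)"
        using norm_inf_triangle[of t z s] norm_inf_triangle[of s z y] by linarith
      then show ?thesis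
        using tz s(2) y(2) norm_inf_minus_commute[of s y] norm_inf_minus_commute[of y z]
        by (simp add: algebra_simps)
    qed
    ultimately have "X \<union> Y \<in> skeletons L (Suc k) x" using X(1) Y(1) y(1) s(1) by auto
    then show ?case using X(2) Y(2) by blast
  qed
  then show thesis using that by blast
qed

subsection \<open>Decay of the lazy walk on the integers\<close>

definition binomial_weight :: "real \<Rightarrow> nat \<Rightarrow> nat \<Rightarrow> real" where
  "binomial_weight p n j = real (n choose j) * p ^ j * (1 - p) ^ (n - j)"

lemma binomial_weight_nonneg: "0 \<le> p \<Longrightarrow> p \<le> 1 \<Longrightarrow> 0 \<le> binomial_weight p n j"
  by (simp add: binomial_weight_def)

lemma sum_binomial_weight: "(\<Sum>j\<le>n. binomial_weight p n j) = 1"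
  using binomial_ring[of p "1 - p" n] by (simp add: binomial_weight_def)

text \<open>Pascal's rule: condition on the outcome of one of the \<open>Suc n\<close>
  trials.\<close>

lemma sum_binomial_weight_Suc:
  "(\<Sum>j\<le>Suc n. binomial_weight p (Suc n) j * c j) =
    (1 - p) * (\<Sum>j\<le>n. binomial_weight p n j * c j) + p * (\<Sum>j\<le>n. binomial_weight p n j * c (Suc j))"
proof -
  have Suc: "binomial_weight p (Suc n) (Suc j) =
      p * binomial_weight p n j + real (n choose Suc j) * p ^ Suc j * (1 - p) ^ (n - j)" for j
    by (simp add: binomial_weight_def algebra_simps)
  have shift: "(\<Sum>j\<le>n. real (n choose Suc j) * p ^ Suc j * (1 - p) ^ (n - j) * c (Suc j)) =
      (\<Sum>j<n. (1 - p) * binomial_weight p n (Suc j) * c (Suc j))"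
  proof -
    have "(\<Sum>j<n. real (n choose Suc j) * p ^ Suc j * (1 - p) ^ (n - j) * c (Suc j)) =
      (\<Sum>j<n. (1 - p) * binomial_weight p n (Suc j) * c (Suc j))"
    proof (rule sum.cong[OF refl])
      fix j assume "j \<in> {..<n}"
      then have "n - j = Suc (n - Suc j)" by simp
      then show "real (n choose Suc j) * p ^ Suc j * (1 - p) ^ (n - j) * c (Suc j) =
          (1 - p) * binomial_weight p n (Suc j) * c (Suc j)"
        by (simp add: binomial_weight_def)
    qed
    then show ?thesis by (simp add: lessThan_Suc_atMost[symmetric])
  qed
  have "(\<Sum>j\<le>Suc n. binomial_weight p (Suc n) j * c j) =
      binomial_weight p (Suc n) 0 * c 0 + (\<Sum>j\<le>n. binomial_weight p (Suc n) (Suc j) * c (Suc j))"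
    by (rule sum.atMost_Suc_shift)
  also have "(\<Sum>j\<le>n. binomial_weight p (Suc n) (Suc j) * c (Suc j)) =
      p * (\<Sum>j\<le>n. binomial_weight p n j * c (Suc j)) +
      (\<Sum>j<n. (1 - p) * binomial_weight p n (Suc j) * c (Suc j))"
    unfolding Suc shift[symmetric] by (simp add: distrib_right sum.distrib sum_distrib_left mult.assoc)
  also have "binomial_weight p (Suc n) 0 = (1 - p) * binomial_weight p n 0"
    by (simp add: binomial_weight_def)
  also have "(1 - p) * binomial_weight p n 0 * c 0 +
      (p * (\<Sum>j\<le>n. binomial_weight p n j * c (Suc j)) +
       (\<Sum>j<n. (1 - p) * binomial_weight p n (Suc j) * c (Suc j))) =
      (1 - p) * (binomial_weight p n 0 * c 0 + (\<Sum>j<n. binomial_weight p n (Suc j) * c (Suc j))) +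
      p * (\<Sum>j\<le>n. binomial_weight p n j * c (Suc j))"
    by (simp add: distrib_left sum_distrib_left mult.assoc)
  also have "binomial_weight p n 0 * c 0 + (\<Sum>j<n. binomial_weight p n (Suc j) * c (Suc j)) =
      (\<Sum>j\<le>n. binomial_weight p n j * c j)"
    by (rule sum.atMost_shift[symmetric])
  finally show ?thesis .
qed

text \<open>The left side is the expectation of 1/(1 + B) for a binomial B. Multiplied by
  \<open>p * real (Suc n)\<close>, its terms become the weights of \<open>Suc n\<close> trials at
  \<open>Suc j\<close>, which sum to at most 1.\<close>

lemma sum_binomial_weight_inverse:
  assumes "0 < p" "p \<le> 1"
  shows "(\<Sum>j\<le>n. binomial_weight p n j * (1 / real (Suc j))) \<le> 1 / (p * real (Suc n))"
proof -
  have "p * real (Suc n) * (binomial_weight p n j * (1 / real (Suc j))) = binomial_weight p (Suc n) (Suc j)" for j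
  proof -
    have "real (Suc n) * real (n choose j) = real (Suc n choose Suc j) * real (Suc j)"
      by (simp only: of_nat_mult[symmetric] Suc_times_binomial_eq)
    then have "real (Suc n) * real (n choose j) / real (Suc j) = real (Suc n choose Suc j)" by (simp add: divide_eq_eq)
    moreover have "p * real (Suc n) * (binomial_weight p n j * (1 / real (Suc j))) =
        (real (Suc n) * real (n choose j) / real (Suc j)) * p ^ Suc j * (1 - p) ^ (n - j)"
      by (simp add: binomial_weight_def)
    ultimately show ?thesis by (simp add: binomial_weight_def)
  qed
  then have "p * real (Suc n) * (\<Sum>j\<le>n. binomial_weight p n j * (1 / real (Suc j))) =
      (\<Sum>j\<le>n. binomial_weight p (Suc n) (Suc j))" by (simp only: sum_distrib_left)
  also have "\<dots> \<le> binomial_weight p (Suc n) 0 + (\<Sum>j\<le>n. binomial_weight p (Suc n) (Suc j))"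
    using binomial_weight_nonneg[of p "Suc n" 0] assms by simp
  also have "\<dots> = 1" 
    using sum_binomial_weight[of p "Suc n"] by (simp only: sum.atMost_Suc_shift)
  finally show ?thesis using assms by (simp add: pos_le_divide_eq mult.commute del: of_nat_Suc)
qed

text \<open>This is the law of the number of heads in \<open>j\<close> fair coin tosses. The case
  distinction is needed because \<open>nat k\<close> is 0 for negative \<open>k\<close>, which would
  give weight 1 / 2^j instead of 0.\<close>

definition fair_walk :: "nat \<Rightarrow> int \<Rightarrow> real" where
  "fair_walk j k = (if k < 0 then 0 else real (j choose nat k) / 2 ^ j)"

lemma fair_walk_Suc: "fair_walk (Suc j) k = (fair_walk j k + fair_walk j (k - 1)) / 2"
proof (cases "k \<le> 0")
  case False
  then have "nat k = Suc (nat (k - 1))" by simp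
  then show ?thesis using False by (simp add: fair_walk_def field_simps del: nat_diff_distrib)
qed (auto simp: fair_walk_def)

lemma central_binomial_upper_bound: "real (2 * n choose n) / 4 ^ n \<le> 1 / sqrt (real (Suc n))"
proof -
  \<comment> \<open>In this squared form the left side is 1 at \<open>n = 0\<close> and does not
    increase: the ratio of consecutive values is at most 1 because (2n+1)^2 (n+2) <= (2n+2)^2
    (n+1).\<close>
  have "(real (2 * n choose n) / 4 ^ n)\<^sup>2 * real (Suc n) \<le> 1"
  proof (induction n)
    case (Suc n)
    have "Suc n * (2 * Suc n choose Suc n) = Suc (Suc (2 * n)) * (Suc (2 * n) choose n)"
      using Suc_times_binomial_eq[of "Suc (2 * n)" n] by (simp add: mult.commute)
    also have "Suc (2 * n) choose n = Suc (2 * n) choose Suc n"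
      using binomial_symmetric[of n "Suc (2 * n)"] by (simp add: Suc_diff_le)
    also have "Suc (Suc (2 * n)) * (Suc (2 * n) choose Suc n) = 2 * ((Suc (2 * n) choose Suc n) * Suc n)"
      by (simp add: algebra_simps)
    also have "(Suc (2 * n) choose Suc n) * Suc n = (2 * n + 1) * (2 * n choose n)"
      using Suc_times_binomial_eq[of "2 * n" n] by simp
    finally have "Suc n * (2 * Suc n choose Suc n) = 2 * (2 * n + 1) * (2 * n choose n)"
      by (simp only: mult.assoc)
    then have "(real n + 1) * real (2 * Suc n choose Suc n) = 2 * (2 * real n + 1) * real (2 * n choose n)"
      by (metis (no_types, lifting) of_nat_1 of_nat_Suc of_nat_add of_nat_mult of_nat_numeral add.commute)
    then have "real (2 * Suc n choose Suc n) = 2 * (2 * real n + 1) * real (2 * n choose n) / (real n + 1)"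
      by (simp add: eq_divide_eq mult.commute del: mult_Suc_right binomial_Suc_Suc)
    then have step: "real (2 * Suc n choose Suc n) / 4 ^ Suc n =
        (2 * real n + 1) / (2 * (real n + 1)) * (real (2 * n choose n) / 4 ^ n)"
    proof -
      have "2 * b * a / c / (4 * e) = b / (2 * c) * (a / e)" for a b c e :: real by (simp add: mult_ac)
      then show ?thesis using \<open>real (2 * Suc n choose Suc n) = _\<close> by (simp only: power_Suc)
    qed
    have "(q * r)\<^sup>2 * real (Suc (Suc n)) = q\<^sup>2 * (real n + 2) / (real n + 1) * (r\<^sup>2 * real (Suc n))"
      for q r :: real by (simp add: power_mult_distrib field_simps)
    then have "(real (2 * Suc n choose Suc n) / 4 ^ Suc n)\<^sup>2 * real (Suc (Suc n)) =
        ((2 * real n + 1) / (2 * (real n + 1)))\<^sup>2 * (real n + 2) / (real n + 1) *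
        ((real (2 * n choose n) / 4 ^ n)\<^sup>2 * real (Suc n))"
      unfolding step .
    also have "\<dots> \<le> 1 * 1"
    proof (rule mult_mono[OF _ Suc])
      have "(2 * real n + 1)\<^sup>2 * (real n + 2) \<le> (2 * (real n + 1))\<^sup>2 * (real n + 1)"
        by (simp add: power2_eq_square algebra_simps)
      then show "((2 * real n + 1) / (2 * (real n + 1)))\<^sup>2 * (real n + 2) / (real n + 1) \<le> 1"
        by (simp add: power_divide divide_le_eq mult_ac)
    qed auto
    finally show ?case by simp
  qed simp
  then have "(real (2 * n choose n) / 4 ^ n)\<^sup>2 \<le> 1 / real (Suc n)"
    by (simp add: pos_le_divide_eq del: of_nat_Suc)
  then have "real (2 * n choose n) / 4 ^ n \<le> sqrt (1 / real (Suc n))" by (intro real_le_rsqrt)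
  then show ?thesis by (simp add: real_sqrt_divide)
qed

lemma fair_walk_le: "fair_walk (2 * n) k \<le> 1 / sqrt (real (Suc n))"
proof (cases "k < 0")
  case False
  have "2 * n choose nat k \<le> 2 * n choose n" using binomial_maximum[of "2 * n" "nat k"] by simp
  then have "fair_walk (2 * n) k \<le> real (2 * n choose n) / 4 ^ n"
    using False by (simp add: fair_walk_def power_mult divide_right_mono)
  also note central_binomial_upper_bound
  finally show ?thesis .
qed (simp add: fair_walk_def)

text \<open>
  A lazy walk on the integers with step probabilities \<open>p/4, 1 - p/2, p/4\<close> is active in a binomial number
  \<open>j\<close> of its steps, and an active step has the law of two fair steps from \<open>{0, 1}\<close>, recentred by \<open>-1\<close>.
\<close>

definition lazy_walk :: "real \<Rightarrow> nat \<Rightarrow> int \<Rightarrow> real" where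
  "lazy_walk p n k = (\<Sum>j\<le>n. binomial_weight p n j * fair_walk (2 * j) (k + int j))"

lemma lazy_walk_0: "lazy_walk p 0 k = (if k = 0 then 1 else 0)"
  by (auto simp: lazy_walk_def binomial_weight_def fair_walk_def)

lemma lazy_walk_nonneg: "0 \<le> p \<Longrightarrow> p \<le> 1 \<Longrightarrow> 0 \<le> lazy_walk p n k"
  unfolding lazy_walk_def
  by (intro sum_nonneg mult_nonneg_nonneg binomial_weight_nonneg) (auto simp: fair_walk_def)

text \<open>Condition on whether one step is active. An active step is two fair steps, so applying
  Pascal's rule twice gives the weights 1, 2, 1 over 4.\<close>

lemma lazy_walk_Suc:
  "lazy_walk p (Suc n) k = (1 - p) * lazy_walk p n k +
     p * ((lazy_walk p n (k + 1) + 2 * lazy_walk p n k + lazy_walk p n (k - 1)) / 4)"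
proof -
  have "fair_walk (2 * Suc j) (k + int (Suc j)) =
      (fair_walk (2 * j) (k + 1 + int j) + 2 * fair_walk (2 * j) (k + int j) +
        fair_walk (2 * j) (k - 1 + int j)) / 4" for j
  proof -
    have "2 * Suc j = Suc (Suc (2 * j))" "k + int (Suc j) = k + 1 + int j"
      "k + 1 + int j - 1 = k + int j" "k + int j - 1 = k - 1 + int j" by simp_all
    then show ?thesis by (simp only: fair_walk_Suc) (simp add: field_simps)
  qed
  then have "(\<Sum>j\<le>n. binomial_weight p n j * fair_walk (2 * Suc j) (k + int (Suc j))) =
      (lazy_walk p n (k + 1) + 2 * lazy_walk p n k + lazy_walk p n (k - 1)) / 4"
    unfolding lazy_walk_def
    by (simp only: sum_distrib_left sum.distrib[symmetric] sum_divide_distrib)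
      (rule sum.cong[OF refl], simp add: algebra_simps)
  then show ?thesis
    unfolding lazy_walk_def[of p "Suc n"] sum_binomial_weight_Suc by (simp only: lazy_walk_def)
qed

text \<open>Given \<open>j\<close> active steps the bound is 1 / sqrt (j + 1). The
  arithmetic-geometric mean inequality replaces this by a term linear in 1 / (j + 1), whose binomial
  average is bounded exactly, so no concentration estimate is required.\<close>

lemma lazy_walk_le:
  assumes "0 < p" "p \<le> 1" "0 < n"
  shows "lazy_walk p n k \<le> 1 / (p * sqrt (real n))"
proof -
  have "fair_walk (2 * j) (k + int j) \<le> sqrt n / 2 * (1 / real (Suc j)) + 1 / (2 * sqrt n)" for j
  proof -
    define s where "s = sqrt (real (Suc j))"
    define t where "t = sqrt (real n)"
    have s: "0 < s" "real (Suc j) = s\<^sup>2" and t: "0 < t" using assms by (simp_all add: s_def t_def)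
    \<comment> \<open>Expanding the square is the arithmetic-geometric mean inequality. The scale
      \<open>t\<close> = sqrt n makes both resulting terms of order 1 / sqrt n.\<close>
    have "0 \<le> (1 / s - 1 / t)\<^sup>2 * t" using t by simp
    also have "\<dots> = t / s\<^sup>2 + 1 / t - 2 / s" using s(1) t by (simp add: power2_eq_square field_simps)
    finally have "1 / s \<le> t / 2 * (1 / s\<^sup>2) + 1 / (2 * t)" by simp
    moreover have "fair_walk (2 * j) (k + int j) \<le> 1 / s" unfolding s_def by (rule fair_walk_le)
    ultimately show ?thesis unfolding t_def[symmetric] s(2) by linarith
  qed
  then have "lazy_walk p n k \<le>
      (\<Sum>j\<le>n. binomial_weight p n j * (sqrt n / 2 * (1 / real (Suc j)) + 1 / (2 * sqrt n)))"
    unfolding lazy_walk_def using assms by (intro sum_mono mult_left_mono binomial_weight_nonneg) auto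
  also have "\<dots> = sqrt n / 2 * (\<Sum>j\<le>n. binomial_weight p n j * (1 / real (Suc j))) +
      (\<Sum>j\<le>n. binomial_weight p n j) * (1 / (2 * sqrt n))"
    by (simp add: distrib_left sum.distrib sum_distrib_left sum_distrib_right
      sum_divide_distrib mult_ac)
  also have "\<dots> \<le> sqrt n / 2 * (1 / (p * real n)) + 1 / (2 * sqrt n)"
  proof -
    have "1 / (p * real (Suc n)) \<le> 1 / (p * real n)" using assms by (intro divide_left_mono) auto
    then show ?thesis using sum_binomial_weight_inverse[OF assms(1,2), of n] assms
      by (intro add_mono mult_left_mono) (auto simp: sum_binomial_weight)
  qed
  also have "sqrt n / 2 * (1 / (p * real n)) = 1 / (2 * p * sqrt n)"
    using assms real_sqrt_mult_self[of "real n"] by (simp add: field_simps)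
  also have "1 / (2 * p * sqrt n) + 1 / (2 * sqrt n) \<le> 1 / (2 * p * sqrt n) + 1 / (2 * p * sqrt n)"
    using assms by (intro add_left_mono divide_left_mono) (auto simp: mult_le_cancel_right1)
  finally show ?thesis by simp
qed

subsection \<open>Hitting probabilities of the directed walk\<close>

definition diagonal_step :: "'d \<Rightarrow> int \<Rightarrow> 'd::{finite,linorder} site" where
  "diagonal_step j s = (\<chi> i. if i = Max UNIV then 1 else if i = j then s else 0)"

lemma diagonal_step_in_J:
  assumes "j \<noteq> Max UNIV" "\<bar>s\<bar> = 1"
  shows "diagonal_step j s \<in> J"
proof -
  have "(\<Sum>i\<in>UNIV - {Max UNIV}. \<bar>diagonal_step j s $ i\<bar>) = (\<Sum>i\<in>UNIV - {Max UNIV}. if i = j then 1 else 0)"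
    using assms by (intro sum.cong) (auto simp: diagonal_step_def)
  also have "\<dots> = 1" using assms by (simp add: sum.delta)
  finally show ?thesis by (simp add: J_def diagonal_step_def)
qed

text \<open>The horizontal coordinates have absolute values summing to 1, so a nonzero one uses up
  the whole sum.\<close>

lemma J_eq_diagonal_step:
  assumes "v \<in> J" "j \<noteq> Max UNIV" "v $ j \<noteq> 0"
  shows "\<bar>v $ j\<bar> = 1 \<and> v = diagonal_step j (v $ j)"
proof -
  let ?R = "UNIV - {Max UNIV} - {j}"
  have "(\<Sum>i\<in>UNIV - {Max UNIV}. \<bar>v $ i\<bar>) = \<bar>v $ j\<bar> + (\<Sum>i\<in>?R. \<bar>v $ i\<bar>)"
    using assms(2) by (intro sum.remove) auto
  moreover have "0 \<le> (\<Sum>i\<in>?R. \<bar>v $ i\<bar>)" by (intro sum_nonneg) simp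
  moreover have "1 \<le> \<bar>v $ j\<bar>" using assms(3) by simp
  moreover have "(\<Sum>i\<in>UNIV - {Max UNIV}. \<bar>v $ i\<bar>) = 1" using assms(1) by (simp add: J_def)
  ultimately have *: "\<bar>v $ j\<bar> = 1" "(\<Sum>i\<in>?R. \<bar>v $ i\<bar>) = 0" by linarith+
  then have "\<forall>i\<in>?R. v $ i = 0" by (subst (asm) sum_nonneg_eq_0_iff) auto
  then show ?thesis using * assms(1) by (auto simp: vec_eq_iff diagonal_step_def J_def)
qed

lemma J_component_le: "v \<in> J \<Longrightarrow> \<bar>v $ i\<bar> \<le> 1"
  using J_eq_diagonal_step[of v i] by (cases "i = Max UNIV"; cases "v $ i = 0") (auto simp: J_def)

text \<open>Exactly two steps of \<open>J\<close> move coordinate \<open>j\<close>, one in each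
  direction. Each coordinate of the directed walk is thus a lazy walk.\<close>

lemma sum_J_component:
  fixes j :: "'d::{finite,linorder}"
  assumes "j \<noteq> Max UNIV"
  shows "(\<Sum>v\<in>(J :: 'd site set). g (v $ j)) = g 1 + g (-1) + (real (card (J :: 'd site set)) - 2) * g 0"
proof -
  let ?a = "diagonal_step j 1" and ?b = "diagonal_step j (-1)"
  have j: "?a $ j = 1" "?b $ j = -1" using assms by (auto simp: diagonal_step_def)
  then have ab: "?a \<noteq> ?b" by auto
  have in_J: "?a \<in> J" "?b \<in> J" using assms diagonal_step_in_J by force+
  have zero: "v $ j = 0" if "v \<in> J - {?a} - {?b}" for v
  proof (rule ccontr)
    assume "v $ j \<noteq> 0"
    then have "\<bar>v $ j\<bar> = 1" "v = diagonal_step j (v $ j)" using J_eq_diagonal_step that assms by auto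
    then show False using that by (metis Diff_iff abs_eq_iff' insertI1 abs_1)
  qed
  have "(\<Sum>v\<in>J. g (v $ j)) = g 1 + (g (-1) + (\<Sum>v\<in>J - {?a} - {?b}. g (v $ j)))"
  proof -
    have "(\<Sum>v\<in>J. g (v $ j)) = g (?a $ j) + (\<Sum>v\<in>J - {?a}. g (v $ j))"
      using in_J by (intro sum.remove finite_J)
    moreover have "(\<Sum>v\<in>J - {?a}. g (v $ j)) = g (?b $ j) + (\<Sum>v\<in>J - {?a} - {?b}. g (v $ j))"
      using in_J ab by (intro sum.remove finite_Diff finite_J) auto
    ultimately show ?thesis unfolding j by simp
  qed
  also have "(\<Sum>v\<in>J - {?a} - {?b}. g (v $ j)) = (\<Sum>v\<in>J - {?a} - {?b}. g 0)"
    using zero by (intro sum.cong) auto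
  also have "\<dots> = (real (card (J :: 'd site set)) - 2) * g 0"
  proof -
    have "card {?a, ?b} \<le> card (J :: 'd site set)" using in_J finite_J by (intro card_mono) auto
    then have "2 \<le> card (J :: 'd site set)" using ab by simp
    moreover have "card (J - {?a} - {?b}) = card (J :: 'd site set) - 2" using in_J ab by simp
    ultimately show ?thesis by (simp add: of_nat_diff)
  qed
  finally show ?thesis by simp
qed

text \<open>Dimension at least 3 provides two horizontal axes with two directions each. Having at
  least four steps makes \<open>4 / card J\<close> at most 1, as required of the activity parameter
  of \<open>lazy_walk\<close>.\<close>

lemma card_J_ge:
  assumes "3 \<le> CARD('d)"
  shows "4 \<le> card (J :: 'd::{finite,linorder} site set)"
proof -
  have "2 \<le> card (UNIV - {Max UNIV :: 'd})" using assms by simp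
  then obtain A where A: "A \<subseteq> UNIV - {Max UNIV :: 'd}" "card A = 2" by (metis obtain_subset_with_card_n)
  then obtain j k where "j \<noteq> k" "j \<noteq> Max UNIV" "k \<noteq> (Max UNIV :: 'd)"
    by (auto simp: card_2_iff)
  have v: "diagonal_step j s $ j = s" "diagonal_step j s $ k = 0" "diagonal_step k s $ k = s" for s
    using \<open>j \<noteq> k\<close> \<open>j \<noteq> Max UNIV\<close> \<open>k \<noteq> Max UNIV\<close> by (auto simp: diagonal_step_def)
  let ?F = "{diagonal_step j 1, diagonal_step j (-1), diagonal_step k 1, diagonal_step k (-1)}"
  have "diagonal_step j 1 \<noteq> diagonal_step j (-1)" "diagonal_step k 1 \<noteq> diagonal_step k (-1)"
    "diagonal_step j s \<noteq> diagonal_step k 1" "diagonal_step j s \<noteq> diagonal_step k (-1)" for s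
    using v by (metis one_neq_neg_one zero_neq_neg_one zero_neq_one)+
  then have "card ?F = 4" by simp
  moreover have "?F \<subseteq> J"
    using diagonal_step_in_J[of j] diagonal_step_in_J[of k] \<open>j \<noteq> Max UNIV\<close> \<open>k \<noteq> Max UNIV\<close> by simp
  ultimately show ?thesis using card_mono[OF finite_J, of ?F] by simp
qed

section \<open>Walks as partial sums of i.i.d. steps\<close>

abbreviation step_law :: "'d::finite site set \<Rightarrow> (nat \<Rightarrow> 'd site) measure" where
  "step_law S \<equiv> Pi\<^sub>M UNIV (\<lambda>_::nat. uniform_count_measure S)"

lemma measurable_partial_sum:
  "(\<lambda>\<xi>. x + (\<Sum>i<n. \<xi> i)) \<in> measurable (step_law S) (count_space UNIV)"
proof (induction n)
  case (Suc n)
  have "(\<lambda>y. y) \<in> measurable (uniform_count_measure S) (count_space UNIV)"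
    by (simp add: measurable_def space_uniform_count_measure sets_uniform_count_measure)
  then have c: "(\<lambda>\<xi>. \<xi> n) \<in> measurable (step_law S) (count_space UNIV)"
    by (rule measurable_compose[OF measurable_component_singleton, rotated]) simp
  have "(\<lambda>\<xi>. (\<lambda>a b. a + b) (x + (\<Sum>i<n. \<xi> i)) (\<xi> n)) \<in> measurable (step_law S) (count_space UNIV)"
    by (rule measurable_compose_countable[OF _ Suc], rule measurable_compose[OF c]) simp
  then show ?case by (simp add: add.assoc)
qed simp

lemma sets_partial_sum: "{\<xi> \<in> space (step_law S). x + (\<Sum>i<n. \<xi> i) \<in> B} \<in> sets (step_law S)"
  using measurable_sets[OF measurable_partial_sum[where S=S and n=n and x=x], of B]
  by (simp add: vimage_def Int_def conj_commute)

lemma measurable_walk: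
  "(\<lambda>\<xi> n. x + (\<Sum>i<n. \<xi> i)) \<in> measurable (step_law S) (coord_algebra (paths S))"
  unfolding coord_algebra_def
proof (rule measurable_restrict_space2)
  show "(\<lambda>\<xi> n. x + (\<Sum>i<n. \<xi> i)) \<in> space (step_law S) \<rightarrow> paths S"
    by (auto simp: paths_def space_PiM space_uniform_count_measure PiE_iff algebra_simps)
  show "(\<lambda>\<xi> n. x + (\<Sum>i<n. \<xi> i)) \<in> measurable (step_law S) (Pi\<^sub>M UNIV (\<lambda>_. count_space UNIV))"
    by (rule measurable_PiM_single') (auto simp: measurable_partial_sum)
qed

text \<open>Condition on the first step: prepending an independent step to the sequence leaves the
  product measure invariant.\<close>

lemma emeasure_partial_sum_Suc:
  assumes "finite S" "S \<noteq> {}"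
  shows "emeasure (step_law S) {\<xi> \<in> space (step_law S). (\<Sum>i<Suc n. \<xi> i) = y} =
    (\<Sum>v\<in>S. ennreal (1 / card S) * emeasure (step_law S) {\<xi> \<in> space (step_law S). (\<Sum>i<n. \<xi> i) = y - v})"
proof -
  let ?M = "uniform_count_measure S"
  interpret M: prob_space ?M by (rule prob_space_uniform_count_measure[OF assms])
  interpret product_prob_space "\<lambda>_. ?M" "UNIV :: nat set"
    by (intro product_prob_spaceI M.prob_space_axioms)
  interpret sequence_space ?M by unfold_locales
  have S: "prob_space (step_law S)" by (intro prob_space_PiM M.prob_space_axioms)
  let ?E = "{\<xi> \<in> space (step_law S). (\<Sum>i<Suc n. \<xi> i) = y}"
  let ?f = "\<lambda>(s, \<omega>). case_nat s \<omega>"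
  have E: "?E \<in> sets (step_law S)" using sets_partial_sum[of S 0 "Suc n" "{y}"] by simp
  have f: "?f \<in> measurable (?M \<Otimes>\<^sub>M step_law S) (step_law S)" by measurable
  have "emeasure (step_law S) ?E = emeasure (distr (?M \<Otimes>\<^sub>M step_law S) (step_law S) ?f) ?E"
    by (simp only: PiM_iter)
  also have "\<dots> = emeasure (?M \<Otimes>\<^sub>M step_law S) (?f -` ?E \<inter> space (?M \<Otimes>\<^sub>M step_law S))"
    by (rule emeasure_distr[OF f E])
  also have "\<dots> = (\<integral>\<^sup>+ v. emeasure (step_law S) (Pair v -` (?f -` ?E \<inter> space (?M \<Otimes>\<^sub>M step_law S))) \<partial>?M)"
    by (rule sigma_finite_measure.emeasure_pair_measure_alt[OF prob_space_imp_sigma_finite[OF S] measurable_sets[OF f E]])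
  also have "\<dots> = (\<integral>\<^sup>+ v. emeasure (step_law S) {\<xi> \<in> space (step_law S). (\<Sum>i<n. \<xi> i) = y - v} \<partial>?M)"
  proof (intro nn_integral_cong arg_cong2[of _ _ _ _ emeasure] refl)
    fix v assume v: "v \<in> space ?M"
    have "case_nat v \<xi> \<in> space (step_law S)" if "\<xi> \<in> space (step_law S)" for \<xi>
      using measurable_space[OF f, of "(v, \<xi>)"] v that by (simp add: space_pair_measure)
    moreover have "(\<Sum>i<Suc n. case_nat v \<xi> i) = v + (\<Sum>i<n. \<xi> i)" for \<xi>
      by (simp only: sum.lessThan_Suc_shift nat.case)
    moreover have "v + a = y \<longleftrightarrow> a = y - v" for a by (auto simp: algebra_simps)
    ultimately show "Pair v -` (?f -` ?E \<inter> space (?M \<Otimes>\<^sub>M step_law S)) =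
        {\<xi> \<in> space (step_law S). (\<Sum>i<n. \<xi> i) = y - v}"
      using v by (auto simp: space_pair_measure simp del: sum.lessThan_Suc)
  qed
  also have "\<dots> = (\<Sum>v\<in>S. ennreal (1 / card S) * emeasure (step_law S) {\<xi> \<in> space (step_law S). (\<Sum>i<n. \<xi> i) = y - v})"
    unfolding uniform_count_measure_def by (rule nn_integral_point_measure_finite[OF assms(1)])
  finally show ?thesis .
qed

text \<open>Being at \<open>y\<close> forces coordinate \<open>j\<close> to be \<open>y $ j\<close>,
  and this coordinate performs the lazy walk with parameter \<open>4 / card J\<close>. The induction
  compares the two first-step recursions.\<close>

lemma emeasure_backward_walk_le_lazy_walk:
  fixes j :: "'d::{finite,linorder}" and y :: "'d site"
  assumes "3 \<le> CARD('d)" "j \<noteq> Max UNIV"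
  defines "M \<equiv> step_law (uminus ` J :: 'd site set)"
  shows "emeasure M {\<xi> \<in> space M. (\<Sum>i<n. \<xi> i) = y} \<le>
    ennreal (lazy_walk (4 / card (J :: 'd site set)) n (y $ j))"
proof (induction n arbitrary: y)
  case 0
  have ne: "(uminus ` J :: 'd site set) \<noteq> {}" using J_nonempty[where 'd='d] assms(1) by simp
  interpret prob_space M
    unfolding M_def using finite_J ne by (intro prob_space_PiM prob_space_uniform_count_measure) auto
  show ?case
  proof (cases "y $ j = 0")
    case False
    then have "y \<noteq> 0" by auto
    then show ?thesis by simp
  qed (simp add: lazy_walk_0 emeasure_le_1)
next
  case (Suc n)
  let ?J = "J :: 'd site set"
  define m where "m = real (card ?J)"
  define h where "h = lazy_walk (4 / m) n"
  have m: "4 \<le> m" using card_J_ge[OF assms(1)] by (simp add: m_def)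
  have nonneg: "0 \<le> h k" for k unfolding h_def using m by (intro lazy_walk_nonneg) auto
  have inj: "inj_on uminus ?J" by (simp add: inj_on_def)
  have card: "card (uminus ` ?J) = card ?J" by (rule card_image[OF inj])
  have ne: "finite (uminus ` ?J)" "(uminus ` ?J) \<noteq> {}" using J_nonempty[where 'd='d] assms(1) finite_J by auto
  have "emeasure M {\<xi> \<in> space M. (\<Sum>i<Suc n. \<xi> i) = y} =
      (\<Sum>v\<in>uminus ` ?J. ennreal (1 / m) * emeasure M {\<xi> \<in> space M. (\<Sum>i<n. \<xi> i) = y - v})"
    unfolding M_def emeasure_partial_sum_Suc[OF ne] card m_def ..
  also have "\<dots> \<le> (\<Sum>v\<in>uminus ` ?J. ennreal (1 / m) * ennreal (h ((y - v) $ j)))"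
  proof (intro sum_mono mult_left_mono)
    fix v
    show "emeasure M {\<xi> \<in> space M. (\<Sum>i<n. \<xi> i) = y - v} \<le> ennreal (h ((y - v) $ j))"
      unfolding h_def m_def by (rule Suc)
  qed simp
  also have "\<dots> = (\<Sum>v\<in>?J. ennreal (1 / m * h (y $ j + v $ j)))"
    using nonneg m by (subst sum.reindex[OF inj]) (simp add: ennreal_mult[symmetric])
  also have "\<dots> = ennreal (\<Sum>v\<in>?J. 1 / m * h (y $ j + v $ j))"
    using nonneg m by (intro sum_ennreal) simp
  also have "(\<Sum>v\<in>?J. 1 / m * h (y $ j + v $ j)) =
      1 / m * h (y $ j + 1) + 1 / m * h (y $ j - 1) + (m - 2) * (1 / m * h (y $ j))"
    using sum_J_component[OF assms(2), of "\<lambda>k. 1 / m * h (y $ j + k)"] by (simp add: m_def)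
  \<comment> \<open>For p = 4/m the recursion puts p/4 = 1/m on each neighbor and 1 - p + p/2 = (m -
    2)/m on staying.\<close>
  also have "\<dots> = lazy_walk (4 / m) (Suc n) (y $ j)"
    unfolding lazy_walk_Suc h_def[symmetric] using m by (simp add: field_simps)
  finally show ?case unfolding m_def .
qed

lemma abs_component_partial_sum_le:
  assumes "\<And>i. \<xi> i \<in> uminus ` J"
  shows "\<bar>(\<Sum>i<n. \<xi> i) $ k\<bar> \<le> int n"
proof -
  have "\<bar>\<xi> i $ k\<bar> \<le> 1" for i
  proof -
    obtain v where "v \<in> J" "\<xi> i = - v" using assms[of i] by auto
    then show ?thesis using J_component_le[of v k] by simp
  qed
  then have "(\<Sum>i<n. \<bar>\<xi> i $ k\<bar>) \<le> int n" using sum_bounded_above[of "{..<n}" "\<lambda>i. \<bar>\<xi> i $ k\<bar>" 1] by simp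
  moreover have "\<bar>\<Sum>i<n. \<xi> i $ k\<bar> \<le> (\<Sum>i<n. \<bar>\<xi> i $ k\<bar>)" by (rule sum_abs)
  ultimately show ?thesis unfolding sum_component by linarith
qed

text \<open>The last coordinate drops by exactly 1 at each step and no coordinate moves faster.
  Hence a site can be visited only at the time equal to its distance from the start.\<close>

lemma norm_inf_backward_walk:
  fixes \<xi> :: "nat \<Rightarrow> 'd::{finite,linorder} site"
  assumes "\<And>i. \<xi> i \<in> uminus ` J"
  shows "norm_inf (\<Sum>i<n. \<xi> i) = int n"
proof (rule antisym)
  show "norm_inf (\<Sum>i<n. \<xi> i) \<le> int n"
    unfolding norm_inf_le_iff using abs_component_partial_sum_le[of \<xi> n] assms by blast
  have "\<xi> i $ Max UNIV = - 1" for i using assms[of i] by (auto simp: J_def)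
  then have "(\<Sum>i<n. \<xi> i) $ Max UNIV = - int n" by simp
  then show "int n \<le> norm_inf (\<Sum>i<n. \<xi> i)"
    using abs_component_le_norm_inf[of "\<Sum>i<n. \<xi> i" "Max UNIV"] by simp
qed

section \<open>Escape probabilities and the mass of trajectories hitting a set\<close>

lemma hitting_time_tilde_infinity: "hitting_time_tilde K w = \<infinity> \<longleftrightarrow> (\<forall>n\<ge>1. w n \<notin> K)"
  unfolding hitting_time_tilde_def top_enat_def[symmetric] Inf_top_conv
  by (auto simp: top_enat_def)

lemma space_coord_algebra: "space (coord_algebra A) = A"
  by (simp add: coord_algebra_def space_restrict_space space_PiM)

lemma sets_coord_algebra_component: "{w \<in> A. w n \<in> B} \<in> sets (coord_algebra A)"
proof -
  have "(\<lambda>w. w n) \<in> measurable (coord_algebra A) (count_space UNIV)"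
    unfolding coord_algebra_def
    by (rule measurable_restrict_space1) (rule measurable_component_singleton, simp)
  from measurable_sets[OF this, of B] show ?thesis
    by (simp add: space_coord_algebra vimage_def Int_def conj_commute)
qed

text \<open>A union bound over the sites of \<open>X\<close> other than \<open>x\<close>, which the
  walk never revisits. With m = \<open>card J\<close>, each \<open>y\<close> is visited with
  probability at most (m/4) / sqrt of its distance, so the bound 2/m on the sum makes the total at
  most 1/2.\<close>

lemma escape_probability_ge:
  fixes x :: "'d::{finite,linorder} site"
  assumes "3 \<le> CARD('d)" "finite X"
    and sum_le: "(\<Sum>y\<in>X - {x}. 1 / sqrt (norm_inf (x - y))) \<le> 2 / card (J :: 'd site set)"
  shows "1 / 2 \<le> emeasure (P_minus x) (W_minus \<inter> {w. hitting_time_tilde X w = \<infinity>})"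
proof -
  let ?S = "uminus ` J :: 'd site set"
  let ?M = "step_law ?S"
  define m where "m = real (card (J :: 'd site set))"
  have m: "4 \<le> m" using card_J_ge[OF assms(1)] by (simp add: m_def)
  have S: "finite ?S" "?S \<noteq> {}" using J_nonempty[where 'd='d] assms(1) finite_J by auto
  interpret M: prob_space ?M by (intro prob_space_PiM prob_space_uniform_count_measure S)
  obtain j :: 'd where j: "j \<noteq> Max UNIV"
  proof -
    have "UNIV - {Max UNIV :: 'd} \<noteq> {}"
    proof
      assume "UNIV - {Max UNIV :: 'd} = {}"
      then have "card (UNIV - {Max UNIV :: 'd}) = 0" by (simp only: card.empty)
      moreover have "card (UNIV - {Max UNIV :: 'd}) = CARD('d) - 1" by (rule card_Diff_singleton) simp
      ultimately show False using assms(1) by linarith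
    qed
    then show thesis using that by blast
  qed
  \<comment> \<open>The only time at which the backward walk from \<open>x\<close> can be at
    \<open>y\<close>.\<close>
  define r where "r = (\<lambda>y. nat (norm_inf (x - y)))"
  let ?H = "\<lambda>y. {\<xi> \<in> space ?M. (\<Sum>i<r y. \<xi> i) = y - x}"
  let ?E = "{\<xi> \<in> space ?M. \<exists>n\<ge>1. x + (\<Sum>i<n. \<xi> i) \<in> X}"
  have H: "?H y \<in> sets ?M" for y using sets_partial_sum[of ?S 0 "r y" "{y - x}"] by simp
  have E: "?E \<subseteq> (\<Union>y\<in>X - {x}. ?H y)"
  proof
    fix \<xi> assume "\<xi> \<in> ?E"
    then obtain n where n: "1 \<le> n" "x + (\<Sum>i<n. \<xi> i) \<in> X" and \<xi>: "\<xi> \<in> space ?M" by blast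
    define y where "y = x + (\<Sum>i<n. \<xi> i)"
    have "\<xi> i \<in> ?S" for i using \<xi> by (auto simp: space_PiM space_uniform_count_measure PiE_iff)
    then have "norm_inf (y - x) = int n" using norm_inf_backward_walk[of \<xi> n] by (simp add: y_def)
    then have "r y = n" "y \<noteq> x"
      using n(1) norm_inf_eq_0[of "y - x"] unfolding r_def norm_inf_minus_commute[of x] by auto
    then show "\<xi> \<in> (\<Union>y\<in>X - {x}. ?H y)" using n(2) \<xi> by (intro UN_I[of y]) (auto simp: y_def)
  qed
  have "emeasure ?M (?H y) \<le> ennreal (m / 4 * (1 / sqrt (norm_inf (x - y))))" if "y \<in> X - {x}" for y
  proof -
    have "0 < norm_inf (x - y)" using that norm_inf_pos_iff[of "x - y"] by auto
    then have r: "0 < r y" "real (r y) = norm_inf (x - y)" by (simp_all add: r_def)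
    have "emeasure ?M (?H y) \<le> ennreal (lazy_walk (4 / m) (r y) ((y - x) $ j))"
      unfolding m_def by (rule emeasure_backward_walk_le_lazy_walk[OF assms(1) j])
    also have "\<dots> \<le> ennreal (1 / (4 / m * sqrt (r y)))"
      using m r(1) by (intro ennreal_leI lazy_walk_le) auto
    finally show ?thesis unfolding r(2) by simp
  qed
  then have "(\<Sum>y\<in>X - {x}. emeasure ?M (?H y)) \<le> (\<Sum>y\<in>X - {x}. ennreal (m / 4 * (1 / sqrt (norm_inf (x - y)))))"
    by (rule sum_mono)
  also have "\<dots> = ennreal (m / 4 * (\<Sum>y\<in>X - {x}. 1 / sqrt (norm_inf (x - y))))"
    unfolding sum_distrib_left using m by (intro sum_ennreal mult_nonneg_nonneg) (auto simp: norm_inf_nonneg)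
  also have "\<dots> \<le> ennreal (m / 4 * (2 / m))"
    using sum_le m unfolding m_def[symmetric] by (intro ennreal_leI mult_left_mono) auto
  also have "m / 4 * (2 / m) = 1 / 2" using m by simp
  finally have sum: "(\<Sum>y\<in>X - {x}. emeasure ?M (?H y)) \<le> ennreal (1 / 2)" .
  have "emeasure ?M (\<Union>y\<in>X - {x}. ?H y) \<le> (\<Sum>y\<in>X - {x}. emeasure ?M (?H y))"
    using assms(2) H by (intro emeasure_subadditive_finite) auto
  then have hit: "emeasure ?M (\<Union>y\<in>X - {x}. ?H y) \<le> ennreal (1 / 2)" using sum by (rule order_trans)
  let ?T = "W_minus \<inter> {w. hitting_time_tilde X w = \<infinity>}"
  have T: "?T = (\<Inter>n\<in>{1..}. {w \<in> W_minus. w n \<in> - X})"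
    by (auto simp: hitting_time_tilde_infinity)
  have sets_T: "?T \<in> sets (coord_algebra W_minus)"
    unfolding T
  proof (rule sets.countable_INT')
    show "(\<lambda>n. {w \<in> W_minus. w n \<in> - X}) ` {1..} \<subseteq> sets (coord_algebra W_minus)"
      by (intro image_subsetI sets_coord_algebra_component)
  qed auto
  have sets_UN: "(\<Union>y\<in>X - {x}. ?H y) \<in> sets ?M" using H assms(2) by (intro sets.finite_UN) auto
  have "1 - M.prob (\<Union>y\<in>X - {x}. ?H y) = M.prob (space ?M - (\<Union>y\<in>X - {x}. ?H y))"
    using M.prob_compl[OF sets_UN] by simp
  moreover have "M.prob (\<Union>y\<in>X - {x}. ?H y) \<le> 1 / 2"
    using hit unfolding M.emeasure_eq_measure by (subst (asm) ennreal_le_iff) auto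
  ultimately have "ennreal (1 / 2) \<le> emeasure ?M (space ?M - (\<Union>y\<in>X - {x}. ?H y))"
    unfolding M.emeasure_eq_measure by (intro ennreal_leI) linarith
  also have "\<dots> \<le> emeasure ?M ((\<lambda>\<xi> n. x + (\<Sum>i<n. \<xi> i)) -` ?T \<inter> space ?M)"
  proof (rule emeasure_mono[OF _ measurable_sets[OF measurable_walk sets_T]])
    have "(\<lambda>n. x + (\<Sum>i<n. \<xi> i)) \<in> ?T" if "\<xi> \<in> space ?M - (\<Union>y\<in>X - {x}. ?H y)" for \<xi>
    proof -
      have "\<xi> \<notin> ?E" using E that by blast
      then have "\<forall>n\<ge>1. x + (\<Sum>i<n. \<xi> i) \<notin> X" using that by blast
      moreover have "(\<lambda>n. x + (\<Sum>i<n. \<xi> i)) \<in> W_minus"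
        using measurable_space[OF measurable_walk, of \<xi> ?S x] that by (simp add: space_coord_algebra)
      ultimately show ?thesis by (simp add: hitting_time_tilde_infinity)
    qed
    then show "space ?M - (\<Union>y\<in>X - {x}. ?H y) \<subseteq> (\<lambda>\<xi> n. x + (\<Sum>i<n. \<xi> i)) -` ?T \<inter> space ?M" by blast
  qed
  also have "\<dots> = emeasure (P_minus x) ?T"
    unfolding walk_law_def by (rule emeasure_distr[OF measurable_walk sets_T, symmetric])
  finally have "ennreal (1 / 2) \<le> emeasure (P_minus x) ?T" .
  moreover have "ennreal (1 / 2) = 1 / 2" using divide_ennreal[of 1 2] by simp
  ultimately show ?thesis by (simp only:)
qed

text \<open>Split according to the position at time 0. The forward factor has mass 1, so each site
  contributes its escape probability; the total mass of \<open>Q\<close> is the capacity of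
  \<open>X\<close> for the directed walk.\<close>

lemma is_Q_mass_ge:
  fixes X :: "'d::{finite,linorder} site set"
  assumes "3 \<le> CARD('d)" "finite X" "is_Q X Q"
    and "\<And>x. x \<in> X \<Longrightarrow> (\<Sum>y\<in>X - {x}. 1 / sqrt (norm_inf (x - y))) \<le> 2 / card (J :: 'd site set)"
  shows "of_nat (card X) * (1 / 2) \<le> emeasure Q W"
proof -
  have J: "finite (J :: 'd site set)" "(J :: 'd site set) \<noteq> {}"
    using J_nonempty[where 'd='d] assms(1) finite_J by auto
  have sets_Q: "sets Q = sets (coord_algebra W)" using assms(3) by (simp add: is_Q_def)
  let ?E = "\<lambda>x. {w \<in> W. w (0::int) = x}"
  have E: "?E x \<in> sets Q" for x
    using sets_coord_algebra_component[of W 0 "{x}"] unfolding sets_Q by simp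
  have "1 / 2 \<le> emeasure Q (?E x)" if "x \<in> X" for x
  proof -
    have A: "W_minus \<in> sets (coord_algebra W_minus)" "W_plus \<in> sets (coord_algebra W_plus)"
      using sets.top[of "coord_algebra W_minus"] sets.top[of "coord_algebra W_plus"]
      by (simp_all only: space_coord_algebra)
    have "(\<lambda>n. w (- int n)) \<in> W_minus \<and> (\<lambda>n. w (int n)) \<in> W_plus" if "w \<in> W" for w :: "int \<Rightarrow> 'd site"
    proof -
      have w: "w (n + 1) - w n \<in> J" for n using that by (simp add: W_def)
      have "w (- int (n + 1)) - w (- int n) \<in> uminus ` J" for n
        using w[of "- int (n + 1)"] by (intro image_eqI[of _ _ "w (- int n) - w (- int (n + 1))"]) auto
      moreover have "w (int (n + 1)) - w (int n) \<in> J" for n using w[of "int n"] by (simp add: add.commute)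
      ultimately show ?thesis unfolding paths_def by blast
    qed
    then have "?E x = {w \<in> W. (\<lambda>n. w (- int n)) \<in> W_minus \<and> w 0 = x \<and> (\<lambda>n. w (int n)) \<in> W_plus}"
      by blast
    moreover have "emeasure Q {w \<in> W. (\<lambda>n. w (- int n)) \<in> W_minus \<and> w 0 = x \<and> (\<lambda>n. w (int n)) \<in> W_plus} =
        emeasure (P_minus x) (W_minus \<inter> {w. hitting_time_tilde X w = \<infinity>}) * emeasure (P_plus x) W_plus"
      using assms(3) A that unfolding is_Q_def by blast
    moreover have "emeasure (P_plus x) W_plus = 1"
      using prob_space.emeasure_space_1[OF prob_space_walk_law[OF J, of x]]
      by (simp add: walk_law_def space_coord_algebra)
    ultimately show ?thesis
      using escape_probability_ge[OF assms(1,2) assms(4)[OF that]] by simp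
  qed
  then have "(\<Sum>x\<in>X. 1 / 2) \<le> (\<Sum>x\<in>X. emeasure Q (?E x))" by (rule sum_mono)
  also have "\<dots> = emeasure Q (\<Union>x\<in>X. ?E x)"
    using assms(2) E by (intro sum_emeasure) (auto simp: disjoint_family_on_def)
  also have "\<dots> \<le> emeasure Q W"
  proof (rule emeasure_mono)
    show "W \<in> sets Q" unfolding sets_Q using sets.top[of "coord_algebra W"] by (simp only: space_coord_algebra)
  qed auto
  finally show ?thesis by simp
qed

subsection \<open>Vacancy probabilities and percolation\<close>

lemma space_W_star_algebra: "space W_star_algebra = W_star"
  by (simp add: W_star_algebra_def space_measure_of_conv)

lemma measurable_proj: "proj \<in> measurable (coord_algebra W) W_star_algebra"
  unfolding W_star_algebra_def
  by (rule measurable_measure_of) (auto simp: space_coord_algebra W_star_eq)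

text \<open>Evaluating both sides of the defining identity of \<open>is_nu\<close> on the whole
  space \<open>W_star\<close> gives equality of the total masses.\<close>

lemma emeasure_nu_hit:
  assumes "is_nu \<nu>" "finite X"
  obtains Q where "is_Q X Q" "emeasure \<nu> (W_star_hit X) = emeasure Q W"
proof -
  have sets_\<nu>: "sets \<nu> = sets W_star_algebra" using assms(1) by (simp add: is_nu_def)
  obtain Q where Q: "is_Q X Q" "density \<nu> (indicator (W_star_hit X)) = distr Q W_star_algebra proj"
    using assms unfolding is_nu_def by blast
  have sets_Q: "sets Q = sets (coord_algebra W)" using Q(1) by (simp add: is_Q_def)
  have space: "space Q = W" "space \<nu> = W_star"
    using sets_eq_imp_space_eq[OF sets_Q] sets_eq_imp_space_eq[OF sets_\<nu>]
    by (simp_all add: space_coord_algebra space_W_star_algebra)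
  have hit: "W_star_hit X \<in> sets \<nu>" unfolding sets_\<nu> by (rule sets_W_star_hit[OF assms(2)])
  have top: "W_star \<in> sets \<nu>" using sets.top[of \<nu>] unfolding space .
  have proj: "proj \<in> measurable Q W_star_algebra"
    using measurable_proj measurable_cong_sets[OF sets_Q refl] by blast
  have "emeasure \<nu> (W_star_hit X) = emeasure (density \<nu> (indicator (W_star_hit X))) W_star"
  proof -
    have "W_star_hit X \<inter> W_star = W_star_hit X" using sets.sets_into_space[OF hit] space by blast
    moreover have "indicator (W_star_hit X) \<in> borel_measurable \<nu>" using hit by simp
    ultimately show ?thesis
      using hit top by (subst emeasure_density) (simp_all add: indicator_inter_arith[symmetric])
  qed
  also have "\<dots> = emeasure Q (proj -` W_star \<inter> space Q)"
    unfolding Q(2) by (rule emeasure_distr[OF proj top[unfolded sets_\<nu>]])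
  also have "proj -` W_star \<inter> space Q = W" unfolding space by (auto simp: W_star_eq)
  finally show thesis using that Q(1) by blast
qed

section \<open>Void probabilities of the Poisson process\<close>

lemma sigma_finite_half_line: "sigma_finite_measure half_line"
  unfolding half_line_def by (intro sigma_finite_measure_restrict_space sigma_finite_lborel) auto

lemma emeasure_half_line: "0 \<le> u \<Longrightarrow> emeasure half_line {0..u} = ennreal u"
  unfolding half_line_def by (subst emeasure_restrict_space) auto

text \<open>A trajectory that hits \<open>X\<close> hits one of its sites, so the box over
  \<open>X\<close> is a finite union of boxes over single sites, each null by vacancy.\<close>

lemma vacant_subset_imp:
  assumes "\<omega> \<in> Omega" "finite X" "X \<subseteq> vacant_set u \<omega>"
  shows "emeasure \<omega> (W_star_hit X \<times> {0..u}) = 0"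
proof -
  obtain p where p: "\<omega> = dirac_sum p" using assms(1) by (auto simp: Omega_def)
  have sets: "sets \<omega> = sets mark_space" by (simp add: p dirac_sum_def)
  have "W_star_hit X \<times> {0..u} = (\<Union>x\<in>X. W_star_hit {x} \<times> {0..u})"
    using W_star_hit_iff[OF assms(2)] W_star_hit_iff[of "{x}" for x] by auto
  moreover have "W_star_hit {x} \<times> {0..u} \<in> null_sets \<omega>" if "x \<in> X" for x
    using assms(3) that sets_hit_box[of "{x}" u] interlacement_iff[OF assms(1), of x u]
    by (auto simp: vacant_set_def sets intro!: null_setsI)
  ultimately have "W_star_hit X \<times> {0..u} \<in> null_sets \<omega>"
    using assms(2) by (simp only:) (intro null_sets.finite_UN, auto)
  then show ?thesis by blast
qed

lemma prob_no_hit_le: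
  fixes \<nu> :: "'d::{finite,linorder} traj measure"
  assumes "is_nu \<nu>" "is_interlacement_law \<nu> P" "finite X" "0 < u"
    and ge: "ennreal c \<le> emeasure \<nu> (W_star_hit X)"
  shows "measure P {\<omega> \<in> space P. emeasure \<omega> (W_star_hit X \<times> {0..u}) = 0} \<le> exp (- u * c)"
proof -
  let ?D = "W_star_hit X \<times> {0..u}"
  let ?\<mu> = "\<nu> \<Otimes>\<^sub>M half_line"
  interpret P: prob_space P using assms(2) by (simp add: is_interlacement_law_def)
  have poisson: "is_poisson_process ?\<mu> P" using assms(2) by (simp add: is_interlacement_law_def)
  have hit: "W_star_hit X \<in> sets \<nu>" using sets_W_star_hit[OF assms(3)] assms(1) by (simp add: is_nu_def)
  have box: "{0..u} \<in> sets half_line" by (simp add: half_line_def sets_restrict_space_iff)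
  have D: "?D \<in> sets ?\<mu>" using hit box by (rule pair_measureI)
  have \<mu>: "emeasure ?\<mu> ?D = emeasure \<nu> (W_star_hit X) * ennreal u"
    using sigma_finite_measure.emeasure_pair_measure_Times[OF sigma_finite_half_line hit box]
      emeasure_half_line[of u] assms(4) by simp
  show ?thesis
  \<comment> \<open>The Poisson formula is postulated only for finite intensity. For infinite
    intensity the count is almost surely infinite, so the void probability is 0.\<close>
  proof (cases "emeasure ?\<mu> ?D = \<infinity>")
    case True
    then have "AE \<omega> in P. emeasure \<omega> ?D = \<infinity>" using poisson D by (simp add: is_poisson_process_def)
    then have "AE \<omega> in P. \<not> emeasure \<omega> ?D = 0" by eventually_elim simp
    from emeasure_eq_0_AE[OF this] show ?thesis by (simp add: P.emeasure_eq_measure)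
  next
    case False
    then have fin: "emeasure ?\<mu> ?D < \<infinity>" by (simp add: less_top)
    have "measure P {\<omega> \<in> space P. emeasure \<omega> ?D = of_nat 0} =
        exp (- measure ?\<mu> ?D) * measure ?\<mu> ?D ^ 0 / fact 0"
      using poisson D fin unfolding is_poisson_process_def by blast
    moreover have "u * c \<le> measure ?\<mu> ?D"
    \<comment> \<open>\<open>ennreal c\<close> is 0 for negative \<open>c\<close>, so the hypothesis
      then says nothing and the claim follows from nonnegativity.\<close>
    proof (cases "0 \<le> c")
      case True
      have "ennreal (u * c) = ennreal c * ennreal u" using True assms(4) by (simp add: ennreal_mult mult.commute)
      also have "\<dots> \<le> emeasure ?\<mu> ?D" unfolding \<mu> using ge by (intro mult_right_mono) auto
      also have "\<dots> = ennreal (measure ?\<mu> ?D)" using fin by (intro emeasure_eq_ennreal_measure) simp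
      finally show ?thesis by simp
    next
      case False
      then have "u * c \<le> 0" using assms(4) by (simp add: mult_le_0_iff)
      then show ?thesis using measure_nonneg order_trans by blast
    qed
    ultimately show ?thesis by simp
  qed
qed

lemma sets_no_hit:
  assumes "is_interlacement_law \<nu> P" "finite X"
  shows "{\<omega> \<in> space P. emeasure \<omega> (W_star_hit X \<times> {0..u}) = 0} \<in> sets P"
proof -
  have sets_P: "sets P = sets Omega_algebra" using assms(1) by (simp add: is_interlacement_law_def)
  have "{\<omega> \<in> space P. emeasure \<omega> (W_star_hit X \<times> {0..u}) = 0} =
      (\<lambda>\<omega>. emeasure \<omega> (W_star_hit X \<times> {0..u})) -` {0} \<inter> Omega"
    using sets_eq_imp_space_eq[OF sets_P] by (auto simp: space_Omega_algebra)
  also have "\<dots> \<in> sets Omega_algebra"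
    unfolding Omega_algebra_def
    by (rule in_measure_of) (auto simp: sets_hit_box assms(2) intro!: exI[of _ "_ \<times> _"] exI[of _ "{0}"])
  finally show ?thesis unfolding sets_P .
qed

text \<open>Union bound over all skeletons at scale \<open>k\<close>. The constants \<open>L\<close>
  and \<open>N\<close> depend on the dimension alone, so \<open>u\<close> can be chosen large
  against \<open>N\<close> before \<open>k\<close> tends to infinity.\<close>

lemma theta_le_power:
  fixes \<nu> :: "'d::{finite,linorder} traj measure"
  assumes "CARD('d) \<ge> 3" "is_nu \<nu>" "is_interlacement_law \<nu> P" "0 < u"
  defines "L \<equiv> (int (card (J :: 'd site set)))\<^sup>2 + 16"
  defines "N \<equiv> (card {m :: 'd site. norm_inf m \<le> 3 * L})\<^sup>2"
  shows "theta P u \<le> (real N * exp (- u / 2)) ^ 2 ^ k"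
proof -
  interpret P: prob_space P using assms(3) by (simp add: is_interlacement_law_def)
  let ?F = "skeletons L k (0 :: 'd site)"
  let ?A = "\<lambda>X. {\<omega> \<in> space P. emeasure \<omega> (W_star_hit X \<times> {0..u}) = 0}"
  have L: "16 \<le> L" by (simp add: L_def)
  have space_P: "space P = Omega"
    using assms(3) sets_eq_imp_space_eq[of P Omega_algebra]
    by (simp add: is_interlacement_law_def space_Omega_algebra)
  have N_pos: "1 \<le> N"
  proof -
    have "0 \<in> {m :: 'd site. norm_inf m \<le> 3 * L}" using L norm_inf_eq_0[of "0 :: 'd site"] by simp
    then have "card {m :: 'd site. norm_inf m \<le> 3 * L} \<noteq> 0" using finite_norm_inf_ball card_0_eq by blast
    then show ?thesis by (simp add: N_def Suc_le_eq)
  qed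
  have F: "finite ?F" "card ?F \<le> N ^ 2 ^ k"
  proof -
    have "finite ?F \<and> N * card ?F \<le> N ^ 2 ^ k"
      unfolding N_def by (rule finite_card_skeletons)
    moreover have "card ?F \<le> N * card ?F" using N_pos by simp
    ultimately show "finite ?F" "card ?F \<le> N ^ 2 ^ k" by linarith+
  qed
  have fin: "finite X" "card X = 2 ^ k" if "X \<in> ?F" for X using skeleton_card[OF L that] by auto
  have le: "measure P (?A X) \<le> exp (- u / 2) ^ 2 ^ k" if X: "X \<in> ?F" for X
  proof -
    obtain Q where Q: "is_Q X Q" "emeasure \<nu> (W_star_hit X) = emeasure Q W"
      using emeasure_nu_hit[OF assms(2) fin(1)[OF X]] .
    have "(\<Sum>y\<in>X - {x}. 1 / sqrt (norm_inf (x - y))) \<le> 2 / card (J :: 'd site set)" if "x \<in> X" for x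
    proof -
      let ?m = "real (card (J :: 'd site set))"
      have m: "4 \<le> ?m" using card_J_ge[OF assms(1)] by simp
      have "(\<Sum>y\<in>X - {x}. 1 / sqrt (norm_inf (x - y))) \<le> (2 - 2 / 2 ^ k) / sqrt (L - 8)"
        by (rule skeleton_sum[OF L X that])
      also have "\<dots> \<le> 2 / sqrt (L - 8)" using L by (intro divide_right_mono) auto
      also have "\<dots> \<le> 2 / ?m"
      proof -
        \<comment> \<open>By the choice of \<open>L\<close>, \<open>L - 8\<close> is the square of
          \<open>?m\<close> plus 8.\<close>
        have "?m \<le> sqrt (L - 8)" by (rule real_le_rsqrt) (simp add: L_def)
        then show ?thesis using m L by (intro divide_left_mono mult_pos_pos) auto
      qed
      finally show ?thesis .
    qed
    from is_Q_mass_ge[OF assms(1) fin(1)[OF X] Q(1) this]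
    have "of_nat (2 ^ k) * (1 / 2) \<le> emeasure \<nu> (W_star_hit X)" unfolding Q(2) fin(2)[OF X] .
    moreover have "of_nat (2 ^ k) * (1 / 2) = ennreal (2 ^ k / 2)"
      by (simp add: ennreal_of_nat_eq_real_of_nat[symmetric] divide_ennreal[symmetric] ennreal_power[symmetric] ennreal_times_divide)
    ultimately have "measure P (?A X) \<le> exp (- u * (2 ^ k / 2))"
      by (intro prob_no_hit_le[OF assms(2,3) fin(1)[OF X] assms(4)]) simp
    also have "\<dots> = exp (- u / 2) ^ 2 ^ k" by (simp add: exp_of_nat_mult[symmetric])
    finally show ?thesis .
  qed
  have "{\<omega> \<in> space P. connected_to_infinity (vacant_set u \<omega>)} \<subseteq> (\<Union>X\<in>?F. ?A X)"
  proof
    fix \<omega> assume \<omega>: "\<omega> \<in> {\<omega> \<in> space P. connected_to_infinity (vacant_set u \<omega>)}"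
    have "0 < L ^ k" using L by simp
    \<comment> \<open>Connection to infinity is used only at the radius \<open>2 * L ^ k\<close>,
      where a path from the origin crosses the annulus of scale \<open>k\<close>.\<close>
    then have "1 \<le> nat (2 * L ^ k)" by linarith
    then obtain x :: "'d site" where x: "2 * L ^ k \<le> norm_inf x" "connected_in (vacant_set u \<omega>) 0 x"
      using \<omega> \<open>0 < L ^ k\<close> unfolding connected_to_infinity_def by force
    obtain X where X: "X \<in> ?F" "X \<subseteq> vacant_set u \<omega>"
    proof (rule crossing_contains_skeleton[OF _ x(2), of L 0 k])
      show "norm_inf ((0 :: 'd site) - 0) \<le> L ^ k - 1"
        using \<open>0 < L ^ k\<close> norm_inf_eq_0[of "0 :: 'd site"] by simp
    qed (use L x that in auto)
    then show "\<omega> \<in> (\<Union>X\<in>?F. ?A X)"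
      using vacant_subset_imp[OF _ fin(1)[OF X(1)] X(2)] \<omega> space_P by auto
  qed
  then have "theta P u \<le> measure P (\<Union>X\<in>?F. ?A X)"
    unfolding theta_def using sets_no_hit[OF assms(3)] fin(1) F(1)
    by (intro P.finite_measure_mono sets.finite_UN) auto
  also have "\<dots> \<le> (\<Sum>X\<in>?F. measure P (?A X))"
    using sets_no_hit[OF assms(3)] fin(1) F(1) by (intro P.finite_measure_subadditive_finite) auto
  also have "\<dots> \<le> real (card ?F) * exp (- u / 2) ^ 2 ^ k"
    using sum_bounded_above[of ?F, OF le] by simp
  also have "\<dots> \<le> real (N ^ 2 ^ k) * exp (- u / 2) ^ 2 ^ k"
    using F(2) by (intro mult_right_mono) (simp_all only: of_nat_le_iff, simp)
  finally show ?thesis by (simp add: power_mult_distrib)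
qed

theorem theorem3:
  fixes \<nu> :: "'d::{finite,linorder} traj measure"
    and P :: "('d traj \<times> real) measure measure"
  assumes "CARD('d) \<ge> 3"
    and "is_nu \<nu>"
    and "is_interlacement_law \<nu> P"
  shows "\<exists>u\<^sub>c>0. \<forall>u>u\<^sub>c. theta P u = 0"
proof -
  define N where "N = (card {m :: 'd site. norm_inf m \<le> 3 * ((int (card (J :: 'd site set)))\<^sup>2 + 16)})\<^sup>2"
  define u\<^sub>c where "u\<^sub>c = 2 * ln (real N + 1)"
  have "theta P u = 0" if "u\<^sub>c < u" "0 < u" for u
  proof -
    define r where "r = real N * exp (- u / 2)"
    have "exp (ln (real N + 1)) < exp (u / 2)"
      unfolding exp_less_cancel_iff using that(1) by (simp add: u\<^sub>c_def)
    moreover have "exp (ln (real N + 1)) = real N + 1" by (rule exp_ln) linarith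
    ultimately have "real N + 1 < exp (u / 2)" by linarith
    then have r: "0 \<le> r" "r < 1" unfolding r_def by (simp_all add: exp_minus field_simps)
    \<comment> \<open>The bound holds at every scale, and 2^n >= n reduces it to ordinary powers of
      \<open>r < 1\<close>, which tend to 0.\<close>
    have "theta P u \<le> r ^ n" for n
    proof -
      have "theta P u \<le> r ^ 2 ^ n"
        unfolding r_def N_def by (rule theta_le_power[OF assms that(2)])
      also have "\<dots> \<le> r ^ n" using r less_exp[of n] by (intro power_decreasing) auto
      finally show ?thesis .
    qed
    then have "\<not> 0 < theta P u" using real_arch_pow_inv[of "theta P u" r] r(2) by (metis not_le)
    moreover have "0 \<le> theta P u" by (simp add: theta_def)
    ultimately show ?thesis by simp
  qed
  moreover have "0 < u\<^sub>c + 1" by (simp add: u\<^sub>c_def add_nonneg_pos)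
  \<comment> \<open>The logarithm gives only a nonnegative \<open>u\<^sub>c\<close>; adding 1 makes
    the threshold strictly positive.\<close>
  ultimately show ?thesis by (intro exI[of _ "u\<^sub>c + 1"]) auto
qed

end
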